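(* Consider the multi-cell system with one user per cell described in the context ($L$ cells, $M$ antennas per base station, the same unit-norm training sequence $\underline{\psi}$ used by all users, zero-forcing precoding). For every $j\in\{1,\dots,L\}$, the achievable rate $R_j$ of the user in the $j$-th cell, $$R_j=C\left(\frac{\left|\mathbb{E}[g^j_j]\right|^2}{1+\operatorname{var}\{g^j_j\}+\sum_{l\neq j}\mathbb{E}\left[|g^j_l|^2\right]}\right),\qquad g^j_l=\sqrt{p_f\beta_{jl}}\;\underline{h}_{jl}\,\underline{a}_l,$$ is given by $$R_j = C\left(\frac{p_f \beta_{jj}\frac{p_r \tau \beta_{jj}}{\kappa_j}\,\mathbb{E}[\theta]^2}{1+p_f \beta_{jj}\frac{p_r \tau \beta_{jj}}{\kappa_j}\operatorname{var}\{\theta\}+\sum_{l \ne j} p_f \beta_{jl}\frac{p_r \tau \beta_{jl}}{\kappa_l}\mathbb{E}[\theta^2] + \sum_{l=1}^{L} p_f \beta_{jl} \frac{1+ p_r \tau \sum_{i\ne j} \beta_{il}}{\kappa_l}}\right),$$ where $\kappa_l = 1+ p_r \tau \sum_{i=1}^{L} \beta_{il}$ for each $l$, $\theta = \sqrt{\sum_{m=1}^{M}|u_m|^2}$ with $u_1,\dots,u_M$ i.i.d. $\mathcal{CN}(0,1)$, and $$\mathbb{E}[\theta]=\frac{\Gamma(M+\frac{1}{2})}{\Gamma(M)},\qquad \mathbb{E}[\theta^2]=M,\qquad \operatorname{var}\{\theta\}=M-\mathbb{E}[\theta]^2 ,$$ with $\Gamma$ the Gamma function. Moreover, with all other parameters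 fixed, $$\lim_{M \rightarrow \infty} R_j = C\left(\frac{\dfrac{\beta_{jj}^2}{1+ p_r \tau \sum_{i=1}^{L} \beta_{ij}}}{\sum_{l \ne j} \dfrac{\beta_{jl}^2}{1+ p_r \tau \sum_{i=1}^{L} \beta_{il}}}\right),$$ where the right-hand side is read as $+\infty$ if $\sum_{l\neq j}\beta_{jl}^2=0$.
   Context: $C(x)=\log_2(1+x)$. There are $L$ cells, each with one base station having $M$ antennas and one single-antenna user. Fix constants $p_f>0$, $p_r>0$, a positive integer $\tau$, and constants $\beta_{jl}\ge 0$ ($1\le j,l\le L$) with $\beta_{ll}>0$ for all $l$. For $1\le j,l\le L$, $\underline{h}_{jl}$ is the $1\times M$ random row vector of fading coefficients between the base station of cell $l$ and the user of cell $j$; all entries of all $\underline{h}_{jl}$ are i.i.d. $\mathcal{CN}(0,1)$ (zero-mean circularly-symmetric complex Gaussian with variance 1). Uplink training: $\underline{\psi}\in\mathbb{C}^{\tau}$ is a column vector with $\underline{\psi}^\dagger\underline{\psi}=1$ ($\dagger$ is the Hermitian transpose). Base station $l$ observes the $\tau\times M$ matrix $\mathbf{Y}_l=\sqrt{p_r\tau}\sum_{j=1}^L\sqrt{\beta_{jl}}\,\underline{\psi}\,\underline{h}_{jl}+\mathbf{W}_l$, where the entries of the $\mathbf{W}_l$ are i.i.d. $\mathcal{CN}(0,1)$, independent of all $\underline{h}_{jl}$. The MMSE estimate of $\underline{h}_{jl}$ given $\mathbf{Y}_l$ is $\underline{\hat h}_{jl}=\sqrt{p_r\tau\beta_{jl}}\,\underline{\psi}^\dagger\left(\mathbf{I}+p_r\tau\sum_{i=1}^L\beta_{il}\,\underline{\psi}\,\underline{\psi}^\dagger\right)^{-1}\mathbf{Y}_l$.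 Zero-forcing precoding: base station $l$ uses the $M\times 1$ precoding vector $\underline{a}_l=\underline{\hat h}_{ll}^\dagger/\|\underline{\hat h}_{ll}\|$ (almost surely well defined), with $\|\cdot\|$ the two-norm. For a complex random variable $X$, $\operatorname{var}\{X\}=\mathbb{E}[|X-\mathbb{E}X|^2]=\mathbb{E}[|X|^2]-|\mathbb{E}X|^2$. *)

theory Defs
  imports "HOL-Probability.Probability"
begin

text \<open>
  Cells are indexed by a finite type \<open>'l\<close> (so \<open>L = CARD('l)\<close>) and training symbols by a finite
  type \<open>'t\<close> (so \<open>\<tau> = CARD('t)\<close>).  The number \<open>M\<close> of antennas varies, hence antennas are natural
  numbers \<open>m < M\<close>.  As in \<open>\<beta>\<^sub>j\<^sub>l\<close>, the first index is the cell of the user, the second one the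
  cell of the base station.
\<close>

definition cap :: "real \<Rightarrow> real" where
  "cap x = log 2 (1 + x)"

text \<open>Circularly-symmetric complex Gaussian \<open>CN(0,1)\<close>: real and imaginary part are independent
  real Gaussians with mean 0 and variance 1/2 each (\<^const>\<open>normal_density\<close> takes the standard
  deviation).\<close>

definition std_complex_normal :: "'a measure \<Rightarrow> ('a \<Rightarrow> complex) \<Rightarrow> bool" where
  "std_complex_normal P X \<longleftrightarrow>
     prob_space.indep_var P borel (\<lambda>\<omega>. Re (X \<omega>)) borel (\<lambda>\<omega>. Im (X \<omega>)) \<and>
     distributed P lborel (\<lambda>\<omega>. Re (X \<omega>)) (normal_density 0 (sqrt (1/2))) \<and>
     distributed P lborel (\<lambda>\<omega>. Im (X \<omega>)) (normal_density 0 (sqrt (1/2)))"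

definition iid_complex_normal :: "'a measure \<Rightarrow> 'i set \<Rightarrow> ('i \<Rightarrow> 'a \<Rightarrow> complex) \<Rightarrow> bool" where
  "iid_complex_normal P I X \<longleftrightarrow>
     prob_space P \<and> prob_space.indep_vars P (\<lambda>_. borel) X I \<and>
     (\<forall>i\<in>I. std_complex_normal P (X i))"

definition complex_variance :: "'a measure \<Rightarrow> ('a \<Rightarrow> complex) \<Rightarrow> real" where
  "complex_variance P X = (\<integral>\<omega>. (cmod (X \<omega> - (\<integral>\<omega>'. X \<omega>' \<partial>P)))\<^sup>2 \<partial>P)"

text \<open>\<open>h j l m\<close> is the \<open>m\<close>-th entry of the row vector \<open>h\<^sub>j\<^sub>l\<close> and \<open>W l m\<close> the \<open>m\<close>-th column of the
  noise matrix \<open>W\<^sub>l\<close>; all entries of all of these are jointly independent.\<close>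

definition channel_model ::
  "'a measure \<Rightarrow> nat \<Rightarrow> ('l::finite \<Rightarrow> 'l \<Rightarrow> nat \<Rightarrow> 'a \<Rightarrow> complex) \<Rightarrow>
   ('l \<Rightarrow> nat \<Rightarrow> 'a \<Rightarrow> complex ^ 't::finite) \<Rightarrow> bool" where
  "channel_model P M h W \<longleftrightarrow>
     iid_complex_normal P ((UNIV \<times> UNIV \<times> {..<M}) <+> (UNIV \<times> {..<M} \<times> UNIV))
       (case_sum (\<lambda>(j, l, m). h j l m) (\<lambda>(l, m, t) \<omega>. W l m \<omega> $ t))"

definition hermitian :: "complex ^ 't \<Rightarrow> complex ^ 't" where
  "hermitian \<psi> = (\<chi> t. cnj (\<psi> $ t))"

text \<open>The product \<open>\<psi> \<psi>\<^sup>\<dagger>\<close> of a column and a row.\<close>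

definition outer_self :: "complex ^ 't \<Rightarrow> complex ^ 't ^ 't" where
  "outer_self \<psi> = (\<chi> s t. \<psi> $ s * hermitian \<psi> $ t)"

definition received ::
  "real \<Rightarrow> ('l::finite \<Rightarrow> 'l \<Rightarrow> real) \<Rightarrow> complex ^ 't::finite \<Rightarrow>
   ('l \<Rightarrow> 'l \<Rightarrow> nat \<Rightarrow> 'a \<Rightarrow> complex) \<Rightarrow> ('l \<Rightarrow> nat \<Rightarrow> 'a \<Rightarrow> complex ^ 't) \<Rightarrow>
   'l \<Rightarrow> nat \<Rightarrow> 'a \<Rightarrow> complex ^ 't" where
  "received p_r \<beta> \<psi> h W l m \<omega> =
     sqrt (p_r * CARD('t)) *\<^sub>R (\<Sum>j\<in>UNIV. sqrt (\<beta> j l) *\<^sub>R (h j l m \<omega> *s \<psi>)) + W l m \<omega>"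

definition mmse_estimate ::
  "real \<Rightarrow> ('l::finite \<Rightarrow> 'l \<Rightarrow> real) \<Rightarrow> complex ^ 't::finite \<Rightarrow>
   ('l \<Rightarrow> 'l \<Rightarrow> nat \<Rightarrow> 'a \<Rightarrow> complex) \<Rightarrow> ('l \<Rightarrow> nat \<Rightarrow> 'a \<Rightarrow> complex ^ 't) \<Rightarrow>
   'l \<Rightarrow> 'l \<Rightarrow> nat \<Rightarrow> 'a \<Rightarrow> complex" where
  "mmse_estimate p_r \<beta> \<psi> h W j l m \<omega> =
     complex_of_real (sqrt (p_r * CARD('t) * \<beta> j l)) *
     (\<Sum>t\<in>UNIV.
        (hermitian \<psi> v*
           matrix_inv (mat 1 + (p_r * CARD('t)) *\<^sub>R (\<Sum>i\<in>UNIV. \<beta> i l *\<^sub>R outer_self \<psi>))) $ t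
        * received p_r \<beta> \<psi> h W l m \<omega> $ t)"

definition precoder ::
  "real \<Rightarrow> ('l::finite \<Rightarrow> 'l \<Rightarrow> real) \<Rightarrow> complex ^ 't::finite \<Rightarrow> nat \<Rightarrow>
   ('l \<Rightarrow> 'l \<Rightarrow> nat \<Rightarrow> 'a \<Rightarrow> complex) \<Rightarrow> ('l \<Rightarrow> nat \<Rightarrow> 'a \<Rightarrow> complex ^ 't) \<Rightarrow>
   'l \<Rightarrow> nat \<Rightarrow> 'a \<Rightarrow> complex" where
  "precoder p_r \<beta> \<psi> M h W l m \<omega> =
     cnj (mmse_estimate p_r \<beta> \<psi> h W l l m \<omega>) /
     complex_of_real (L2_set (\<lambda>n. cmod (mmse_estimate p_r \<beta> \<psi> h W l l n \<omega>)) {..<M})"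

text \<open>\<open>gain p_f p_r \<beta> \<psi> M h W l j\<close> is \<open>g\<close> with upper index \<open>j\<close> (user) and lower index \<open>l\<close>
  (base station).\<close>

definition gain ::
  "real \<Rightarrow> real \<Rightarrow> ('l::finite \<Rightarrow> 'l \<Rightarrow> real) \<Rightarrow> complex ^ 't::finite \<Rightarrow> nat \<Rightarrow>
   ('l \<Rightarrow> 'l \<Rightarrow> nat \<Rightarrow> 'a \<Rightarrow> complex) \<Rightarrow> ('l \<Rightarrow> nat \<Rightarrow> 'a \<Rightarrow> complex ^ 't) \<Rightarrow>
   'l \<Rightarrow> 'l \<Rightarrow> 'a \<Rightarrow> complex" where
  "gain p_f p_r \<beta> \<psi> M h W l j \<omega> =
     complex_of_real (sqrt (p_f * \<beta> j l)) *
     (\<Sum>m<M. h j l m \<omega> * precoder p_r \<beta> \<psi> M h W l m \<omega>)"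

definition rate ::
  "real \<Rightarrow> real \<Rightarrow> ('l::finite \<Rightarrow> 'l \<Rightarrow> real) \<Rightarrow> complex ^ 't::finite \<Rightarrow> 'a measure \<Rightarrow> nat \<Rightarrow>
   ('l \<Rightarrow> 'l \<Rightarrow> nat \<Rightarrow> 'a \<Rightarrow> complex) \<Rightarrow> ('l \<Rightarrow> nat \<Rightarrow> 'a \<Rightarrow> complex ^ 't) \<Rightarrow>
   'l \<Rightarrow> real" where
  "rate p_f p_r \<beta> \<psi> P M h W j =
     (let g = gain p_f p_r \<beta> \<psi> M h W in
      cap ((cmod (\<integral>\<omega>. g j j \<omega> \<partial>P))\<^sup>2 /
           (1 + complex_variance P (g j j) + (\<Sum>l\<in>UNIV - {j}. \<integral>\<omega>. (cmod (g l j \<omega>))\<^sup>2 \<partial>P))))"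

definition kappa :: "real \<Rightarrow> nat \<Rightarrow> ('l::finite \<Rightarrow> 'l \<Rightarrow> real) \<Rightarrow> 'l \<Rightarrow> real" where
  "kappa p_r \<tau> \<beta> l = 1 + p_r * \<tau> * (\<Sum>i\<in>UNIV. \<beta> i l)"

definition theta :: "nat \<Rightarrow> (nat \<Rightarrow> 'a \<Rightarrow> complex) \<Rightarrow> 'a \<Rightarrow> real" where
  "theta M u \<omega> = sqrt (\<Sum>m<M. (cmod (u m \<omega>))\<^sup>2)"

end

theory Submission
  imports Defs
begin

text \<open>
  Correlating the received pilots with \<open>\<psi>\<close> turns the MMSE estimate at base station \<open>l\<close> into a positive
  multiple of \<open>s = \<Sum>\<^sub>i \<surd>(p\<^sub>r \<tau> \<beta>\<^sub>i\<^sub>l) h\<^sub>i\<^sub>l + w\<close>, whose entries are independent \<open>CN(0, \<kappa>\<^sub>l)\<close>; the positive factor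
  cancels in the precoder.  Regressing \<open>h\<^sub>j\<^sub>l\<close> on \<open>s\<close> gives \<open>h\<^sub>j\<^sub>l = \<gamma> s + e\<close> with \<open>\<gamma> = \<surd>(p\<^sub>r \<tau> \<beta>\<^sub>j\<^sub>l) / \<kappa>\<^sub>l\<close>
  and \<open>e\<close> independent of \<open>s\<close>, so the gain is, up to a constant, \<open>\<gamma> \<parallel>s\<parallel>\<close> plus the component of \<open>e\<close>
  along the unit vector \<open>s / \<parallel>s\<parallel>\<close>.  The first part is a multiple of \<open>\<theta>\<close>, whose square is
  Erlang distributed; the second is uncorrelated with it and has the variance of one entry of \<open>e\<close>.
  Log-convexity of \<open>\<Gamma>\<close> gives \<open>M - 1/2 \<le> (E \<theta>)\<^sup>2 \<le> M\<close>, hence the limit.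
\<close>

section \<open>Circularly-symmetric complex normal measures\<close>

text \<open>The precoder is built from the same channels that it multiplies, so the moments of the
  gain do not factor as they stand. The split into \<open>s\<close> and \<open>e\<close> repairs
  this only if the two parts are independent, not just uncorrelated. Independence is obtained from
  laws: CN(0,v) is the measure \<open>complex_normal v\<close> on the plane, and a change of
  variables shows that the joint law of \<open>(s, e)\<close> is a product. All moments then follow
  from independence of single entries, without conditioning on \<open>s\<close>. In one antenna
  \<open>s\<close> combines i.i.d. CN(0,1) variables: the channels of all users and the noise
  entries, the latter with weights \<open>cnj (\<psi> $ t)\<close>. The squared weights add up to
  the kappa of base station l, the noise contributing exactly 1; so what is left of \<open>s\<close>
  without user j never degenerates. With x = p_r tau beta_jl / kappa_l, an entry of \<open>e\<close>
  has variance 1 - x, and E|g|^2 = p_f beta_jl (x M + 1 - x) for the serving and for every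
  interfering base station alike, since each \<open>s\<close> contains the channel of user j. The
  terms x M survive in the limit; the terms 1 - x form the last sum of the rate formula.\<close>

lemma borel_measurable_Complex [measurable (raw)]:
  "f \<in> borel_measurable M \<Longrightarrow> g \<in> borel_measurable M \<Longrightarrow> (\<lambda>x. Complex (f x) (g x)) \<in> borel_measurable M"
  by (simp add: borel_measurable_complex_iff)

text \<open>Lebesgue measure is determined by its values on boxes, and a box in the plane is a
  product of two intervals. This opens complex integrals to iterated real ones.\<close>

lemma complex_plane_measure:
  "distr (lborel \<Otimes>\<^sub>M lborel) borel (\<lambda>(x, y). Complex x y) = lborel"
proof (rule lborel_eqI[symmetric])
  have meas: "(\<lambda>(x, y). Complex x y) \<in> borel_measurable (lborel \<Otimes>\<^sub>M lborel)"
    unfolding split_beta by measurable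
  fix l u :: complex
  assume "\<And>b. b \<in> Basis \<Longrightarrow> l \<bullet> b \<le> u \<bullet> b"
  from this[of 1] this[of \<i>] have le: "Re l \<le> Re u" "Im l \<le> Im u"
    by (auto simp: Basis_complex_def)
  have vimage: "(\<lambda>(x, y). Complex x y) -` box l u = {Re l<..<Re u} \<times> {Im l<..<Im u}"
    by (auto simp: in_box_complex_iff)
  have "emeasure (distr (lborel \<Otimes>\<^sub>M lborel) borel (\<lambda>(x, y). Complex x y)) (box l u)
      = emeasure (lborel \<Otimes>\<^sub>M lborel) ({Re l<..<Re u} \<times> {Im l<..<Im u})"
    using meas by (subst emeasure_distr) (auto simp: vimage space_pair_measure)
  also have "\<dots> = ennreal (Re u - Re l) * ennreal (Im u - Im l)"
    using le by (subst lborel.emeasure_pair_measure_Times) auto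
  also have "\<dots> = ennreal (\<Prod>b\<in>Basis. (u - l) \<bullet> b)"
    using le by (simp add: Basis_complex_def ennreal_mult')
  finally show "emeasure (distr (lborel \<Otimes>\<^sub>M lborel) borel (\<lambda>(x, y). Complex x y)) (box l u) =
    ennreal (\<Prod>b\<in>Basis. (u - l) \<bullet> b)" .
qed simp

lemma nn_integral_complex:
  assumes [measurable]: "f \<in> borel_measurable borel"
  shows "(\<integral>\<^sup>+z. f z \<partial>lborel) = (\<integral>\<^sup>+x. \<integral>\<^sup>+y. f (Complex x y) \<partial>lborel \<partial>lborel)"
proof -
  have "(\<integral>\<^sup>+z. f z \<partial>lborel) = (\<integral>\<^sup>+p. f (case p of (x, y) \<Rightarrow> Complex x y) \<partial>(lborel \<Otimes>\<^sub>M lborel))"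
    by (subst complex_plane_measure[symmetric], subst nn_integral_distr) auto
  also have "\<dots> = (\<integral>\<^sup>+x. \<integral>\<^sup>+y. f (Complex x y) \<partial>lborel \<partial>lborel)"
    by (subst lborel.nn_integral_fst[symmetric]) (auto simp: case_prod_unfold)
  finally show ?thesis .
qed

text \<open>Multiplication by \<open>c\<close> is a real linear map of determinant |c|^2. The
  Jacobian is produced by two one-dimensional affine substitutions, with factors 1/|b| and |b|/r
  where r = |c|^2.\<close>

lemma nn_integral_complex_mult:
  assumes [measurable]: "f \<in> borel_measurable borel" and c: "c \<noteq> 0"
  shows "(\<integral>\<^sup>+z. f z \<partial>lborel) = ennreal ((cmod c)\<^sup>2) * (\<integral>\<^sup>+z. f (c * z) \<partial>lborel)"
proof -
  define a b where "a = Re c" and "b = Im c"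
  have c_eq: "c = Complex a b" by (simp add: a_def b_def)
  have norm_c: "(cmod c)\<^sup>2 = a\<^sup>2 + b\<^sup>2" by (simp add: cmod_power2 a_def b_def)
  show ?thesis
  proof (cases "b = 0")
    \<comment> \<open>A real \<open>c\<close> is a plain dilation; it is treated apart because the
      substitution of the other case divides by \<open>b\<close>.\<close>
    case True
    then have ca: "c = of_real a" and a: "a \<noteq> 0" using c by (auto simp: c_eq complex_eq_iff)
    have "(\<integral>\<^sup>+z. f z \<partial>lborel)
        = (\<integral>\<^sup>+z. f z \<partial>density (distr lborel borel (\<lambda>x. 0 + a *\<^sub>R x)) (\<lambda>_. \<bar>a\<bar>^DIM(complex)))"
      using lborel_affine[OF a, of "0 :: complex"] by simp
    also have "\<dots> = ennreal ((cmod c)\<^sup>2) * (\<integral>\<^sup>+z. f (c * z) \<partial>lborel)"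
      by (subst nn_integral_density)
         (auto simp: nn_integral_distr nn_integral_cmult norm_c True ca scaleR_conv_of_real)
    finally show ?thesis .
  next
    case b: False
    define r where "r = a\<^sup>2 + b\<^sup>2"
    have r: "r > 0" using b by (simp add: r_def sum_power2_gt_zero_iff)
    have "(\<integral>\<^sup>+z. f (c * z) \<partial>lborel)
        = (\<integral>\<^sup>+x. \<integral>\<^sup>+y. f (Complex (a * x - b * y) (a * y + b * x)) \<partial>lborel \<partial>lborel)"
      by (subst nn_integral_complex) (auto simp: c_eq complex_mult)
    \<comment> \<open>The new variable is the real part s = a x - b y; eliminating y turns the
      imaginary part a y + b x into (r x - a s) / b.\<close>
    also have "\<dots> = (\<integral>\<^sup>+x. ennreal (\<bar>1 / b\<bar>) * \<integral>\<^sup>+s. f (Complex s ((r * x - a * s) / b)) \<partial>lborel \<partial>lborel)"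
    proof (rule nn_integral_cong)
      fix x :: real
      have "a * (a * x / b + (- 1 / b) * s) + b * x = (r * x - a * s) / b"
        "a * x - b * (a * x / b + (- 1 / b) * s) = s" for s
        using b by (simp_all add: field_simps r_def power2_eq_square)
      then show "(\<integral>\<^sup>+y. f (Complex (a * x - b * y) (a * y + b * x)) \<partial>lborel)
        = ennreal (\<bar>1 / b\<bar>) * (\<integral>\<^sup>+s. f (Complex s ((r * x - a * s) / b)) \<partial>lborel)"
        using b by (subst nn_integral_real_affine[where c="-1/b" and t="a * x / b"]) auto
    qed
    also have "\<dots> = ennreal (\<bar>1 / b\<bar>) * (\<integral>\<^sup>+s. \<integral>\<^sup>+x. f (Complex s ((r * x - a * s) / b)) \<partial>lborel \<partial>lborel)"
      by (subst nn_integral_cmult, measurable, subst lborel_pair.Fubini') auto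
    \<comment> \<open>For fixed s the imaginary part is affine in x with slope r / b, so it can be
      taken as the second variable.\<close>
    also have "(\<lambda>s. \<integral>\<^sup>+x. f (Complex s ((r * x - a * s) / b)) \<partial>lborel)
      = (\<lambda>s. ennreal (\<bar>b / r\<bar>) * \<integral>\<^sup>+x. f (Complex s x) \<partial>lborel)"
    proof
      fix s
      have "(r * (a * s / r + (b / r) * x) - a * s) / b = x" for x
        using b r by (simp add: field_simps)
      then show "(\<integral>\<^sup>+x. f (Complex s ((r * x - a * s) / b)) \<partial>lborel)
          = ennreal (\<bar>b / r\<bar>) * (\<integral>\<^sup>+x. f (Complex s x) \<partial>lborel)"
        using b r by (subst nn_integral_real_affine[where c="b/r" and t="a * s / r"]) auto
    qed
    also have "(\<integral>\<^sup>+s. ennreal (\<bar>b / r\<bar>) * (\<integral>\<^sup>+x. f (Complex s x) \<partial>lborel) \<partial>lborel)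
      = ennreal (\<bar>b / r\<bar>) * (\<integral>\<^sup>+z. f z \<partial>lborel)"
      by (subst nn_integral_cmult) (auto simp: nn_integral_complex)
    finally have "(\<integral>\<^sup>+z. f (c * z) \<partial>lborel) = ennreal (1 / r) * (\<integral>\<^sup>+z. f z \<partial>lborel)"
      using b r by (simp add: mult.assoc[symmetric] ennreal_mult'[symmetric] abs_divide)
    then have "ennreal r * (\<integral>\<^sup>+z. f (c * z) \<partial>lborel) = (\<integral>\<^sup>+z. f z \<partial>lborel)"
      using r by (simp add: mult.assoc[symmetric] ennreal_mult'[symmetric])
    then show ?thesis by (simp add: norm_c r_def)
  qed
qed

lemma nn_integral_lborel_translate:
  fixes f :: "'a::euclidean_space \<Rightarrow> ennreal"
  assumes [measurable]: "f \<in> borel_measurable borel"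
  shows "(\<integral>\<^sup>+x. f (c + x) \<partial>lborel) = (\<integral>\<^sup>+x. f x \<partial>lborel)"
  by (subst (2) lborel_distr_plus[of c, symmetric]) (simp add: nn_integral_distr)

section \<open>The law CN(0,v), its scaling and its regression\<close>

text \<open>Here \<open>v\<close> is the total variance E|Z|^2, so each of the two coordinates has
  variance v/2.\<close>

definition complex_normal_density :: "real \<Rightarrow> complex \<Rightarrow> real" where
  "complex_normal_density v z = exp (- (cmod z)\<^sup>2 / v) / (pi * v)"

definition complex_normal :: "real \<Rightarrow> complex measure" where
  "complex_normal v = density lborel (\<lambda>z. ennreal (complex_normal_density v z))"

lemma borel_measurable_complex_normal_density [measurable]:
  "complex_normal_density v \<in> borel_measurable borel"
  unfolding complex_normal_density_def[abs_def] by measurable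

lemma complex_normal_density_nonneg [simp]: "0 < v \<Longrightarrow> 0 \<le> complex_normal_density v z"
  by (simp add: complex_normal_density_def)

lemma sets_complex_normal [measurable_cong, simp]: "sets (complex_normal v) = sets borel"
  by (simp add: complex_normal_def)

lemma space_complex_normal [simp]: "space (complex_normal v) = UNIV"
  by (simp add: complex_normal_def)

lemma complex_normal_density_Complex:
  assumes "0 < v"
  shows "complex_normal_density v (Complex x y)
    = normal_density 0 (sqrt (v / 2)) x * normal_density 0 (sqrt (v / 2)) y"
  using assms
  by (simp add: complex_normal_density_def normal_density_def cmod_power2 real_sqrt_mult
      mult_exp_exp field_simps)

lemma nn_integral_normal_density:
  "0 < \<sigma> \<Longrightarrow> (\<integral>\<^sup>+x. ennreal (normal_density \<mu> \<sigma> x) \<partial>lborel) = 1"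
  by (subst nn_integral_eq_integral) auto

lemma prob_space_complex_normal:
  assumes "0 < v" shows "prob_space (complex_normal v)"
proof
  have "(\<integral>\<^sup>+z. ennreal (complex_normal_density v z) \<partial>lborel) = 1"
    using assms
    by (subst nn_integral_complex)
       (auto simp: complex_normal_density_Complex ennreal_mult nn_integral_cmult nn_integral_multc
         nn_integral_normal_density)
  then show "emeasure (complex_normal v) (space (complex_normal v)) = 1"
    by (simp add: complex_normal_def emeasure_density)
qed

text \<open>Change of variables by two translations: first \<open>y = s - \<alpha> x\<close>, then \<open>x = e + c s\<close>, where
  \<open>c\<close> is the regression coefficient of \<open>x\<close> on \<open>s\<close>.\<close>

lemma complex_normal_regression:
  fixes \<alpha> :: complex
  assumes A: "0 < A" and B: "0 < B"
  defines "k \<equiv> (cmod \<alpha>)\<^sup>2 * A + B"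
  defines "c \<equiv> cnj \<alpha> * of_real (A / k)"
  shows "distr (complex_normal A \<Otimes>\<^sub>M complex_normal B) (borel \<Otimes>\<^sub>M borel)
      (\<lambda>(x, y). (\<alpha> * x + y, x - c * (\<alpha> * x + y))) = complex_normal k \<Otimes>\<^sub>M complex_normal (A * B / k)"
    (is "?L = ?R")
proof -
  have k: "0 < k" using A B by (simp add: k_def add_nonneg_pos)
  interpret NA: prob_space "complex_normal A" using A by (rule prob_space_complex_normal)
  interpret NB: prob_space "complex_normal B" using B by (rule prob_space_complex_normal)
  interpret Nk: prob_space "complex_normal k" using k by (rule prob_space_complex_normal)
  interpret Nv: prob_space "complex_normal (A * B / k)"
    using A B k by (intro prob_space_complex_normal) simp
  \<comment> \<open>Completing the square: with the regression coefficient \<open>c\<close> the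
    exponent has no cross term between \<open>s\<close> and \<open>e\<close>. The normalising
    constants agree because A B = k (A B / k).\<close>
  have density: "complex_normal_density A (c * s + e) * complex_normal_density B (- \<alpha> * (c * s + e) + s)
      = complex_normal_density (A * B / k) e * complex_normal_density k s" for s e
  proof -
    have norm2: "(cmod z)\<^sup>2 = Re z * Re z + Im z * Im z" for z unfolding cmod_power2 by (simp add: power2_eq_square)
    have 1: "(cmod (c * s + e))\<^sup>2 / A + (cmod (- \<alpha> * (c * s + e) + s))\<^sup>2 / B
      = (cmod e)\<^sup>2 / (A * B / k) + (cmod s)\<^sup>2 / k"
    proof -
      obtain a1 a2 where al: "\<alpha> = Complex a1 a2" by (cases \<alpha>)
      obtain s1 s2 where s: "s = Complex s1 s2" by (cases s)
      obtain e1 e2 where e: "e = Complex e1 e2" by (cases e)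
      define q where "q = A / k"
      have qk: "q * k = A" using k by (simp add: q_def)
      have kk: "k = (a1 * a1 + a2 * a2) * A + B" by (simp add: k_def norm2 al)
      have x: "c * Complex s1 s2 + Complex e1 e2 = Complex (q * (a1 * s1 + a2 * s2) + e1) (q * (a1 * s2 - a2 * s1) + e2)"
        by (simp add: c_def q_def[symmetric] al s e complex_eq_iff algebra_simps)
      define n where "n = a1 * a1 + a2 * a2"
      have Bq: "B * q = A * (1 - q * n)" using k by (simp add: q_def n_def kk field_simps)
      \<comment> \<open>A polynomial identity that leaves q free: both quadratic forms differ by a
        multiple of B q - A (1 - q n), which is k q - A and vanishes for q = A / k. Isolating this
        factor keeps division out of the expansion.\<close>
      have "B * (cmod (c * s + e))\<^sup>2 + A * (cmod (- \<alpha> * (c * s + e) + s))\<^sup>2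
          - (k * (cmod e)\<^sup>2 + A * (1 - q * n) * (cmod s)\<^sup>2)
        = (q * n * (cmod s)\<^sup>2 + 2 * ((a1 * s1 + a2 * s2) * e1 + (a1 * s2 - a2 * s1) * e2))
          * (B * q - A * (1 - q * n))"
        unfolding s e x unfolding al norm2 kk n_def by (simp add: algebra_simps)
      then have "B * (cmod (c * s + e))\<^sup>2 + A * (cmod (- \<alpha> * (c * s + e) + s))\<^sup>2
          = k * (cmod e)\<^sup>2 + B * q * (cmod s)\<^sup>2"
        by (simp add: Bq)
      then have "(B * (cmod (c * s + e))\<^sup>2 + A * (cmod (- \<alpha> * (c * s + e) + s))\<^sup>2) / (A * B)
          = (k * (cmod e)\<^sup>2 + B * q * (cmod s)\<^sup>2) / (A * B)" by simp
      moreover have "B * q * (cmod s)\<^sup>2 / (A * B) = (cmod s)\<^sup>2 / k"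
        using A B by (simp add: q_def)
      ultimately show ?thesis using A B by (simp add: add_divide_distrib mult.commute)
    qed
    show ?thesis
      using A B k 1
      by (simp add: complex_normal_density_def mult_exp_exp divide_simps)
         (simp add: algebra_simps)
  qed
  show ?thesis
  proof (rule measure_eqI)
    show "sets ?L = sets ?R" by (simp cong: sets_pair_measure_cong)
    fix Q assume "Q \<in> sets ?L"
    then have Q[measurable]: "Q \<in> sets (borel \<Otimes>\<^sub>M borel)" by simp
    have "emeasure ?L Q = (\<integral>\<^sup>+p. indicator Q p \<partial>?L)" by simp
    also have "\<dots> = (\<integral>\<^sup>+x. \<integral>\<^sup>+y. indicator Q (\<alpha> * x + y, x - c * (\<alpha> * x + y)) \<partial>complex_normal B \<partial>complex_normal A)"
      by (subst nn_integral_distr, measurable, subst NB.nn_integral_fst[symmetric]) auto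
    also have "\<dots> = (\<integral>\<^sup>+x. ennreal (complex_normal_density A x) * \<integral>\<^sup>+y. ennreal (complex_normal_density B y) *
        indicator Q (\<alpha> * x + y, x - c * (\<alpha> * x + y)) \<partial>lborel \<partial>lborel)"
      unfolding complex_normal_def
      by (subst nn_integral_density; measurable) (auto simp: nn_integral_density)
    also have "\<dots> = (\<integral>\<^sup>+x. \<integral>\<^sup>+s. ennreal (complex_normal_density A x * complex_normal_density B (- \<alpha> * x + s)) *
        indicator Q (s, x - c * s) \<partial>lborel \<partial>lborel)"
    proof (rule nn_integral_cong)
      fix x
      have "(\<integral>\<^sup>+y. ennreal (complex_normal_density B y) * indicator Q (\<alpha> * x + y, x - c * (\<alpha> * x + y)) \<partial>lborel)
        = (\<integral>\<^sup>+s. ennreal (complex_normal_density B (- \<alpha> * x + s)) * indicator Q (s, x - c * s) \<partial>lborel)"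
        by (subst nn_integral_lborel_translate[where c="- \<alpha> * x", symmetric]) auto
      then show "ennreal (complex_normal_density A x) *
          (\<integral>\<^sup>+y. ennreal (complex_normal_density B y) * indicator Q (\<alpha> * x + y, x - c * (\<alpha> * x + y)) \<partial>lborel)
        = (\<integral>\<^sup>+s. ennreal (complex_normal_density A x * complex_normal_density B (- \<alpha> * x + s)) *
          indicator Q (s, x - c * s) \<partial>lborel)"
        using A B by (simp add: nn_integral_cmult[symmetric] ennreal_mult' mult.assoc)
    qed
    also have "\<dots> = (\<integral>\<^sup>+s. \<integral>\<^sup>+x. ennreal (complex_normal_density A x * complex_normal_density B (- \<alpha> * x + s)) *
        indicator Q (s, x - c * s) \<partial>lborel \<partial>lborel)"
      by (subst lborel_pair.Fubini') auto
    also have "\<dots> = (\<integral>\<^sup>+s. \<integral>\<^sup>+e. ennreal (complex_normal_density A (c * s + e) * complex_normal_density B (- \<alpha> * (c * s + e) + s)) *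
        indicator Q (s, e) \<partial>lborel \<partial>lborel)"
    proof (rule nn_integral_cong)
      fix s
      show "(\<integral>\<^sup>+x. ennreal (complex_normal_density A x * complex_normal_density B (- \<alpha> * x + s)) *
        indicator Q (s, x - c * s) \<partial>lborel) = (\<integral>\<^sup>+e. ennreal (complex_normal_density A (c * s + e) * complex_normal_density B (- \<alpha> * (c * s + e) + s)) *
        indicator Q (s, e) \<partial>lborel)"
        by (subst nn_integral_lborel_translate[where c="c * s", symmetric]) auto
    qed
    also have "\<dots> = (\<integral>\<^sup>+s. ennreal (complex_normal_density k s) * \<integral>\<^sup>+e. ennreal (complex_normal_density (A * B / k) e) *
        indicator Q (s, e) \<partial>lborel \<partial>lborel)"
      unfolding density using A B k
      by (intro nn_integral_cong) (simp add: nn_integral_cmult[symmetric] ennreal_mult' mult_ac)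
    also have "\<dots> = (\<integral>\<^sup>+s. \<integral>\<^sup>+e. indicator Q (s, e) \<partial>complex_normal (A * B / k) \<partial>complex_normal k)"
      unfolding complex_normal_def
      by (subst nn_integral_density; measurable) (auto simp: nn_integral_density)
    also have "\<dots> = emeasure ?R Q"
      by (subst Nv.emeasure_pair_measure) (auto cong: sets_pair_measure_cong)
    finally show "emeasure ?L Q = emeasure ?R Q" .
  qed
qed

text \<open>The Jacobian |c|^2 cancels against the normalising constant. The case c = -1 is the
  symmetry that later forces the mean to be 0.\<close>

lemma distr_complex_normal_mult:
  assumes A: "0 < A" and c: "c \<noteq> 0"
  shows "distr (complex_normal A) borel ((*) c) = complex_normal ((cmod c)\<^sup>2 * A)"
proof (rule measure_eqI)
  fix Q assume "Q \<in> sets (distr (complex_normal A) borel ((*) c))"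
  then have [measurable]: "Q \<in> sets borel" by simp
  define r where "r = (cmod c)\<^sup>2"
  have r: "0 < r" using c by (simp add: r_def)
  have dens: "r * complex_normal_density (r * A) (c * z) = complex_normal_density A z" for z
    using r by (simp add: complex_normal_density_def norm_mult power_mult_distrib r_def[symmetric])
  have "emeasure (complex_normal (r * A)) Q
      = (\<integral>\<^sup>+z. ennreal (complex_normal_density (r * A) z) * indicator Q z \<partial>lborel)"
    by (simp add: complex_normal_def emeasure_density)
  also have "\<dots> = (\<integral>\<^sup>+z. ennreal (complex_normal_density A z) * indicator Q (c * z) \<partial>lborel)"
    using r A c dens
    by (subst nn_integral_complex_mult[OF _ c])
       (auto simp: nn_integral_cmult[symmetric] mult.assoc[symmetric] ennreal_mult'[symmetric] r_def[symmetric])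
  also have "\<dots> = (\<integral>\<^sup>+z. indicator Q (c * z) \<partial>complex_normal A)"
    by (simp add: complex_normal_def nn_integral_density)
  also have "\<dots> = (\<integral>\<^sup>+z. indicator Q z \<partial>distr (complex_normal A) borel ((*) c))"
    by (subst nn_integral_distr) auto
  finally show "emeasure (distr (complex_normal A) borel ((*) c)) Q = emeasure (complex_normal ((cmod c)\<^sup>2 * A)) Q"
    by (simp add: r_def)
qed simp

text \<open>Writing \<open>exp (- r / v)\<close> as the integral of \<open>exp (- t / v) / v\<close> over \<open>t \<ge> r\<close> and exchanging the
  order of integration reduces the tail probability to areas of annuli.\<close>

lemma emeasure_complex_normal_tail:
  assumes v: "0 < v" and a: "0 \<le> a"
  shows "emeasure (complex_normal v) {z. a < (cmod z)\<^sup>2} = ennreal (exp (- a / v))"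
proof -
  have l: "0 < 1 / v" using v by simp
  have exp_split: "exp ((- r - t) / v) = exp (- (r / v)) * exp (- (t / v))" for r t
    by (simp add: mult_exp_exp diff_divide_distrib)
  \<comment> \<open>Total mass 1 of a probability density evaluates both remaining integrals: index
    0 (exponential) for the inner tail, index 1 for the integral against the area of the
    annulus.\<close>
  have erlang1: "(\<integral>\<^sup>+t. ennreal (erlang_density k (1 / v) t) \<partial>lborel) = 1" for k
  proof -
    interpret prob_space "density lborel (erlang_density k (1 / v))"
      using l by (rule prob_space_erlang_density)
    show ?thesis using emeasure_space_1 by (simp add: emeasure_density)
  qed
  have tail: "(\<integral>\<^sup>+t. ennreal (exp (- t / v) / (pi * v\<^sup>2)) * indicator {r..} t \<partial>lborel)
      = ennreal (exp (- r / v) / (pi * v))" for r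
  proof -
    have "(\<integral>\<^sup>+t. ennreal (exp (- t / v) / (pi * v\<^sup>2)) * indicator {r..} t \<partial>lborel)
      = (\<integral>\<^sup>+t. ennreal (exp (- (r + t) / v) / (pi * v\<^sup>2)) * indicator {r..} (r + t) \<partial>lborel)"
      by (rule nn_integral_lborel_translate[symmetric]) measurable
    also have "\<dots> = (\<integral>\<^sup>+t. ennreal (exp (- r / v) / (pi * v)) * ennreal (erlang_density 0 (1 / v) t) \<partial>lborel)"
      using v by (intro nn_integral_cong)
        (auto simp: erlang_density_def ennreal_mult'[symmetric] indicator_def exp_split power2_eq_square)
    finally show ?thesis by (simp add: nn_integral_cmult erlang1)
  qed
  have area: "emeasure lborel {z. a < (cmod z)\<^sup>2 \<and> (cmod z)\<^sup>2 \<le> t} = ennreal (pi * (t - a))" if "a \<le> t" for t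
  proof -
    have "cmod z \<le> sqrt b \<longleftrightarrow> (cmod z)\<^sup>2 \<le> b" for z b
      using real_sqrt_le_iff[of "(cmod z)\<^sup>2" b] by simp
    then have "{z. a < (cmod z)\<^sup>2 \<and> (cmod z)\<^sup>2 \<le> t} = cball 0 (sqrt t) - cball 0 (sqrt a)"
      by (auto simp: not_le[symmetric])
    then have "emeasure lborel {z. a < (cmod z)\<^sup>2 \<and> (cmod z)\<^sup>2 \<le> t}
      = emeasure lborel (cball (0::complex) (sqrt t)) - emeasure lborel (cball (0::complex) (sqrt a))"
      using emeasure_Diff[of lborel "cball (0::complex) (sqrt a)" "cball 0 (sqrt t)"] that
        emeasure_lborel_cball_finite[of "0::complex" "sqrt a"] by (simp add: subset_cball)
    also have "\<dots> = ennreal (pi * t) - ennreal (pi * a)"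
      using a that by (simp add: emeasure_cball unit_ball_vol_2)
    finally show ?thesis using a that by (simp add: ennreal_minus right_diff_distrib)
  qed
  have "emeasure (complex_normal v) {z. a < (cmod z)\<^sup>2}
      = (\<integral>\<^sup>+z. ennreal (exp (- (cmod z)\<^sup>2 / v) / (pi * v)) * indicator {z. a < (cmod z)\<^sup>2} z \<partial>lborel)"
    by (simp add: complex_normal_def emeasure_density complex_normal_density_def)
  also have "\<dots> = (\<integral>\<^sup>+z. \<integral>\<^sup>+t. ennreal (exp (- t / v) / (pi * v\<^sup>2)) *
      indicator {p. a < (cmod (fst p))\<^sup>2 \<and> (cmod (fst p))\<^sup>2 \<le> snd p} (z, t) \<partial>lborel \<partial>lborel)"
  proof (rule nn_integral_cong)
    fix z :: complex
    show "ennreal (exp (- (cmod z)\<^sup>2 / v) / (pi * v)) * indicator {z. a < (cmod z)\<^sup>2} z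
      = (\<integral>\<^sup>+t. ennreal (exp (- t / v) / (pi * v\<^sup>2)) *
      indicator {p. a < (cmod (fst p))\<^sup>2 \<and> (cmod (fst p))\<^sup>2 \<le> snd p} (z, t) \<partial>lborel)"
    proof (cases "a < (cmod z)\<^sup>2")
      case True
      then show ?thesis using tail[of "(cmod z)\<^sup>2"] by (simp add: indicator_def)
    qed simp
  qed
  also have "\<dots> = (\<integral>\<^sup>+t. \<integral>\<^sup>+z. ennreal (exp (- t / v) / (pi * v\<^sup>2)) *
      indicator {p. a < (cmod (fst p))\<^sup>2 \<and> (cmod (fst p))\<^sup>2 \<le> snd p} (z, t) \<partial>lborel \<partial>lborel)"
    by (subst lborel_pair.Fubini') auto
  also have "\<dots> = (\<integral>\<^sup>+t. ennreal (exp (- t / v) / (pi * v\<^sup>2)) * (ennreal (pi * (t - a)) * indicator {a..} t) \<partial>lborel)"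
  proof (rule nn_integral_cong)
    fix t
    have "(\<integral>\<^sup>+z. ennreal (exp (- t / v) / (pi * v\<^sup>2)) *
      indicator {p. a < (cmod (fst p))\<^sup>2 \<and> (cmod (fst p))\<^sup>2 \<le> snd p} (z, t) \<partial>lborel)
      = (\<integral>\<^sup>+z. ennreal (exp (- t / v) / (pi * v\<^sup>2)) *
      indicator {z. a < (cmod z)\<^sup>2 \<and> (cmod z)\<^sup>2 \<le> t} z \<partial>lborel)"
      by (intro nn_integral_cong) (auto simp: indicator_def)
    also have "\<dots> = ennreal (exp (- t / v) / (pi * v\<^sup>2)) * emeasure lborel {z. a < (cmod z)\<^sup>2 \<and> (cmod z)\<^sup>2 \<le> t}"
      by (subst nn_integral_cmult_indicator) auto
    also have "\<dots> = ennreal (exp (- t / v) / (pi * v\<^sup>2)) * (ennreal (pi * (t - a)) * indicator {a..} t)"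
    proof (cases "a \<le> t")
      case False
      then have "{z. a < (cmod z)\<^sup>2 \<and> (cmod z)\<^sup>2 \<le> t} = {}" by auto
      then have "emeasure lborel {z. a < (cmod z)\<^sup>2 \<and> (cmod z)\<^sup>2 \<le> t} = 0" by (simp only: emeasure_empty)
      then show ?thesis using False by simp
    qed (simp add: area)
    finally show "(\<integral>\<^sup>+z. ennreal (exp (- t / v) / (pi * v\<^sup>2)) *
      indicator {p. a < (cmod (fst p))\<^sup>2 \<and> (cmod (fst p))\<^sup>2 \<le> snd p} (z, t) \<partial>lborel)
      = ennreal (exp (- t / v) / (pi * v\<^sup>2)) * (ennreal (pi * (t - a)) * indicator {a..} t)" .
  qed
  also have "\<dots> = (\<integral>\<^sup>+t. ennreal (exp (- (a + t) / v) / (pi * v\<^sup>2)) * (ennreal (pi * ((a + t) - a)) * indicator {a..} (a + t)) \<partial>lborel)"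
    by (rule nn_integral_lborel_translate[symmetric]) measurable
  \<comment> \<open>The annulus area pi t supplies the linear factor of the Erlang density of index
    1 and cancels the pi of the normalisation.\<close>
  also have "\<dots> = (\<integral>\<^sup>+t. ennreal (exp (- a / v)) * ennreal (erlang_density 1 (1 / v) t) \<partial>lborel)"
    using v by (intro nn_integral_cong)
        (auto simp: erlang_density_def ennreal_mult'[symmetric] indicator_def exp_split power2_eq_square)
  finally show ?thesis by (simp add: nn_integral_cmult erlang1)
qed

section \<open>Moments of complex normal variables and of the norm of a vector of them\<close>

text \<open>The tail formula is the complement of an exponential distribution function. Knowing the
  law, not only its moments, makes sums over antennas Erlang distributed.\<close>

lemma (in prob_space) complex_normal_cmod2_exponential:
  assumes X[measurable]: "random_variable borel X" and d: "distr M borel X = complex_normal v" and v: "0 < v"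
  shows "distributed M lborel (\<lambda>\<omega>. (cmod (X \<omega>))\<^sup>2) (exponential_density (1 / v))"
proof (subst exponential_distributed_iff, use v in simp, safe)
  fix a :: real assume a: "0 \<le> a"
  have "emeasure M {\<omega> \<in> space M. a < (cmod (X \<omega>))\<^sup>2} = emeasure (distr M borel X) {z. a < (cmod z)\<^sup>2}"
    by (subst emeasure_distr) (auto intro!: arg_cong[where f="emeasure M"])
  then have "prob {\<omega> \<in> space M. a < (cmod (X \<omega>))\<^sup>2} = exp (- a / v)"
    by (simp add: measure_def d emeasure_complex_normal_tail[OF v a])
  then show "prob {\<omega> \<in> space M. (cmod (X \<omega>))\<^sup>2 \<le> a} = 1 - exp (- a * (1 / v))"
    using prob_neg[of "\<lambda>\<omega>. a < (cmod (X \<omega>))\<^sup>2"] by (simp add: not_less)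
qed measurable

lemma (in prob_space) complex_normal_moments:
  assumes X[measurable]: "random_variable borel X" and d: "distr M borel X = complex_normal v" and v: "0 < v"
  shows "integrable M X" "expectation X = 0"
    "integrable M (\<lambda>\<omega>. (cmod (X \<omega>))\<^sup>2)" "expectation (\<lambda>\<omega>. (cmod (X \<omega>))\<^sup>2) = v"
proof -
  have D: "distributed M lborel (\<lambda>\<omega>. (cmod (X \<omega>))\<^sup>2) (exponential_density (1 / v))"
    using X d v by (rule complex_normal_cmod2_exponential)
  show "expectation (\<lambda>\<omega>. (cmod (X \<omega>))\<^sup>2) = v"
    using exponential_distributed_expectation[OF _ D] v by simp
  show int2: "integrable M (\<lambda>\<omega>. (cmod (X \<omega>))\<^sup>2)"
    using erlang_ith_moment_integrable[OF _ D, of 1] v by simp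
  show "integrable M X"
  proof (rule Bochner_Integration.integrable_bound[OF Bochner_Integration.integrable_add[OF int2]])
    show "integrable M (\<lambda>_. 1 :: real)" by simp
    have "x \<le> x\<^sup>2 + 1" for x :: real
      using zero_le_power2[of "x - 1/2"] by (simp add: power2_eq_square algebra_simps)
    then show "AE \<omega> in M. norm (X \<omega>) \<le> norm ((cmod (X \<omega>))\<^sup>2 + 1)" by auto
  qed simp
  \<comment> \<open>The law is invariant under negation, hence the mean equals its own
    negative.\<close>
  have "expectation X = (\<integral>z. z \<partial>complex_normal v)"
    by (subst d[symmetric], subst integral_distr) auto
  also have "complex_normal v = distr (complex_normal v) borel ((*) (-1))"
    using distr_complex_normal_mult[OF v, of "-1"] by simp
  also have "(\<integral>z. z \<partial>distr (complex_normal v) borel ((*) (-1))) = - (\<integral>z. z \<partial>complex_normal v)"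
    by (subst integral_distr) auto
  also have "(\<integral>z. z \<partial>complex_normal v) = expectation X"
    by (subst d[symmetric], subst integral_distr) auto
  finally show "expectation X = 0" by simp
qed

text \<open>Rescaling by l leads to the Euler integral of Gamma. \<open>erlang_density k\<close> has
  shape k + 1, and the square root adds 1/2: hence the argument k + 3/2.\<close>

lemma erlang_density_sqrt_moment:
  assumes l: "0 < l"
  shows "(\<integral>\<^sup>+x. ennreal (erlang_density k l x) * ennreal (sqrt x) \<partial>lborel)
    = ennreal (Gamma (real k + 3/2) / (fact k * sqrt l))"
proof -
  have "(\<integral>\<^sup>+x. ennreal (erlang_density k l x) * ennreal (sqrt x) \<partial>lborel)
    = ennreal \<bar>1 / l\<bar> * (\<integral>\<^sup>+x. ennreal (erlang_density k l (0 + 1 / l * x)) * ennreal (sqrt (0 + 1 / l * x)) \<partial>lborel)"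
    using l by (subst nn_integral_real_affine[where c="1 / l" and t=0]) auto
  also have "\<dots> = (\<integral>\<^sup>+x. ennreal \<bar>1 / l\<bar> * (ennreal (erlang_density k l (0 + 1 / l * x)) * ennreal (sqrt (0 + 1 / l * x))) \<partial>lborel)"
    by (subst nn_integral_cmult) auto
  also have "\<dots> = (\<integral>\<^sup>+t. ennreal (1 / (fact k * sqrt l)) *
      ennreal (indicator {0..} t * t powr ((real k + 3/2) - 1) / exp t) \<partial>lborel)"
  proof (rule nn_integral_cong)
    fix t :: real
    consider "t < 0" | "t = 0" | "t > 0" by linarith
    then show "ennreal \<bar>1 / l\<bar> * (ennreal (erlang_density k l (0 + 1 / l * t)) * ennreal (sqrt (0 + 1 / l * t)))
      = ennreal (1 / (fact k * sqrt l)) * ennreal (indicator {0..} t * t powr ((real k + 3/2) - 1) / exp t)"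
    proof cases
      case 1
      then show ?thesis using l by (simp add: erlang_density_def divide_neg_pos)
    next
      case 2
      then show ?thesis by simp
    next
      case 3
      have "t powr (real k + 3/2 - 1) = t powr (real k) * t powr (1/2)"
        using powr_add[of t "real k" "1/2"] by (simp add: algebra_simps)
      then have "t powr (real k + 3/2 - 1) = t ^ k * sqrt t"
        using 3 by (simp add: powr_realpow powr_half_sqrt)
      then show ?thesis
        using 3 l by (simp add: erlang_density_def ennreal_mult'[symmetric] real_sqrt_divide power_divide
          exp_minus divide_simps)
    qed
  qed
  also have "\<dots> = ennreal (1 / (fact k * sqrt l)) * ennreal (Gamma (real k + 3/2))"
    by (subst nn_integral_cmult) (auto simp: Gamma_conv_nn_integral_real)
  also have "\<dots> = ennreal (Gamma (real k + 3/2) / (fact k * sqrt l))"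
    using l by (simp add: ennreal_mult'[symmetric])
  finally show ?thesis .
qed

text \<open>\<open>R\<close> squared is a sum of n independent exponentials of rate 1/v, thus Erlang
  of index n - 1. Positivity of \<open>R\<close> almost surely is what later makes the beamforming
  direction a unit vector.\<close>

lemma (in prob_space) complex_normal_norm_moments:
  assumes ind: "indep_vars (\<lambda>_. borel) X {..<n}"
    and d: "\<And>m. m < n \<Longrightarrow> distr M borel (X m) = complex_normal v" and v: "0 < v" and n: "1 \<le> n"
  defines "R \<equiv> \<lambda>\<omega>. sqrt (\<Sum>m<n. (cmod (X m \<omega>))\<^sup>2)"
  shows "integrable M R" "expectation R = sqrt v * (Gamma (real n + 1/2) / Gamma (real n))"
    "integrable M (\<lambda>\<omega>. (R \<omega>)\<^sup>2)" "expectation (\<lambda>\<omega>. (R \<omega>)\<^sup>2) = n * v"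
    "AE \<omega> in M. R \<omega> > 0"
proof -
  have rv: "random_variable borel (X m)" if "m < n" for m
    using ind that by (auto simp: indep_vars_def)
  define Q where "Q = (\<lambda>\<omega>. \<Sum>m<n. (cmod (X m \<omega>))\<^sup>2)"
  have R_Q: "R \<omega> = sqrt (Q \<omega>)" and Q_nonneg: "0 \<le> Q \<omega>" for \<omega>
    by (simp_all add: R_def Q_def sum_nonneg)
  have D: "distributed M lborel Q (erlang_density (n - 1) (1 / v))"
    using exponential_distributed_sum[of "{..<n}" "1 / v" "\<lambda>m \<omega>. (cmod (X m \<omega>))\<^sup>2"] n v
      indep_vars_compose2[OF ind, of "\<lambda>_ z. (cmod z)\<^sup>2" "\<lambda>_. borel"]
      complex_normal_cmod2_exponential[OF rv d v]
    unfolding Q_def by (auto simp: lessThan_empty_iff)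
  have Q[measurable]: "random_variable borel Q"
    using distributed_measurable[OF D] by simp
  have R[measurable]: "random_variable borel R"
    unfolding R_Q[abs_def] by measurable
  have R2: "(\<lambda>\<omega>. (R \<omega>)\<^sup>2) = Q"
    using Q_nonneg by (auto simp: R_Q)
  show "integrable M (\<lambda>\<omega>. (R \<omega>)\<^sup>2)"
    unfolding R2 using erlang_ith_moment_integrable[OF _ D, of 1] v by simp
  show "expectation (\<lambda>\<omega>. (R \<omega>)\<^sup>2) = n * v"
    unfolding R2 using erlang_ith_moment[OF _ D, of 1] v n by (simp add: of_nat_diff fact_reduce)
  have fact: "fact (n - Suc 0) = Gamma (real n)"
    using n Gamma_fact[of "n - 1", where 'a=real] by (simp add: of_nat_diff)
  have "(\<integral>\<^sup>+\<omega>. ennreal (R \<omega>) \<partial>M) = (\<integral>\<^sup>+\<omega>. ennreal (sqrt (Q \<omega>)) \<partial>M)"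
    by (simp add: R_Q)
  also have "\<dots> = ennreal (Gamma (real (n - 1) + 3/2) / (fact (n - 1) * sqrt (1 / v)))"
    by (subst distributed_nn_integral[OF D, symmetric]) (use v in \<open>auto simp: erlang_density_sqrt_moment\<close>)
  also have "Gamma (real (n - 1) + 3/2) / (fact (n - 1) * sqrt (1 / v)) = sqrt v * (Gamma (real n + 1/2) / Gamma (real n))"
    using n by (simp add: fact of_nat_diff real_sqrt_divide field_simps)
  finally have nn: "(\<integral>\<^sup>+\<omega>. ennreal (R \<omega>) \<partial>M) = ennreal (sqrt v * (Gamma (real n + 1/2) / Gamma (real n)))" .
  have "has_bochner_integral M R (sqrt v * (Gamma (real n + 1/2) / Gamma (real n)))"
    using v n by (intro has_bochner_integral_nn_integral nn) (auto simp: R_Q Q_nonneg intro!: divide_nonneg_nonneg Gamma_real_nonneg)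
  then show "integrable M R" "expectation R = sqrt v * (Gamma (real n + 1/2) / Gamma (real n))"
    by (auto simp: has_bochner_integral_iff)
  show "AE \<omega> in M. R \<omega> > 0"
  proof -
    \<comment> \<open>The point 0 is removed as a null set, since for n = 1 the density does not
      vanish there.\<close>
    have "AE x in lborel. ennreal (erlang_density (n - 1) (1 / v) x) = 0 \<or> 0 < x"
      using AE_lborel_singleton[of "0::real"] by eventually_elim (auto simp: erlang_density_def)
    then have "AE x in density lborel (erlang_density (n - 1) (1 / v)). 0 < x"
      by (subst AE_density) (auto elim: eventually_mono simp: zero_less_iff_neq_zero)
    then have "AE x in distr M lborel Q. 0 < x"
      by (simp only: distributed_distr_eq_density[OF D])
    then have "AE \<omega> in M. 0 < Q \<omega>"
      by (subst (asm) AE_distr_iff) auto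
    then show ?thesis by (simp add: R_Q)
  qed
qed

section \<open>Complex normal random variables\<close>

lemma borel_measurable_cnj [measurable]: "cnj \<in> borel_measurable borel"
  by (intro borel_measurable_continuous_onI continuous_intros)

text \<open>Injectivity makes the singletons \<open>{h i}\<close> disjoint blocks, so the grouping
  principle applies. It extracts from the global family the variables of one base station or of one
  antenna.\<close>

lemma (in prob_space) indep_vars_reindex:
  assumes ind: "indep_vars M' X (h ` I)" and inj: "inj_on h I"
  shows "indep_vars (\<lambda>i. M' (h i)) (\<lambda>i. X (h i)) I"
proof -
  have "indep_vars (\<lambda>i. PiM {h i} M') (\<lambda>i \<omega>. restrict (\<lambda>j. X j \<omega>) {h i}) I"
    using inj by (intro indep_vars_restrict[OF ind]) (auto simp: disjoint_family_on_def inj_on_eq_iff)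
  then have "indep_vars (\<lambda>i. M' (h i)) (\<lambda>i \<omega>. (restrict (\<lambda>j. X j \<omega>) {h i}) (h i)) I"
    by (rule indep_vars_compose2) (rule measurable_component_singleton, simp)
  then show ?thesis by simp
qed

text \<open>Independence in two layers, across the pairs and inside each pair, flattens to one
  family: the probability of a rectangle factors first over i and then over the two
  components.\<close>

lemma (in prob_space) indep_vars_pair:
  fixes X :: "'i \<Rightarrow> 'a \<Rightarrow> 'b::second_countable_topology" and Y :: "'i \<Rightarrow> 'a \<Rightarrow> 'b"
  assumes I: "finite I" "I \<noteq> {}"
    and joint: "indep_vars (\<lambda>_. borel \<Otimes>\<^sub>M borel) (\<lambda>i \<omega>. (X i \<omega>, Y i \<omega>)) I"
    and pair: "\<And>i. i \<in> I \<Longrightarrow> indep_var borel (X i) borel (Y i)"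
  shows "indep_vars (\<lambda>_. borel) (\<lambda>(i, b). if b then X i else Y i) (I \<times> UNIV)"
proof (subst indep_vars_finite[where E="\<lambda>_. sets borel"])
  have rv: "random_variable borel (X i)" "random_variable borel (Y i)" if "i \<in> I" for i
    using indep_var_rv1[OF pair] indep_var_rv2[OF pair] that by auto
  then show "random_variable borel (case i of (i, b) \<Rightarrow> if b then X i else Y i)"
    if "i \<in> I \<times> UNIV" for i :: "'i \<times> bool"
    using that by (auto split: prod.splits)
  show "\<forall>A\<in>I \<times> UNIV \<rightarrow> sets borel.
    prob (\<Inter>j\<in>I \<times> UNIV. (case j of (i, b) \<Rightarrow> if b then X i else Y i) -` A j \<inter> space M) =
    (\<Prod>j\<in>I \<times> UNIV. prob ((case j of (i, b) \<Rightarrow> if b then X i else Y i) -` A j \<inter> space M))"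
  proof
    fix A :: "'i \<times> bool \<Rightarrow> 'b set" assume A: "A \<in> I \<times> UNIV \<rightarrow> sets borel"
    have A': "A (i, b) \<in> sets borel" if "i \<in> I" for i b using A that by auto
    have "(\<Inter>j\<in>I \<times> UNIV. (case j of (i, b) \<Rightarrow> if b then X i else Y i) -` A j \<inter> space M)
      = (\<Inter>i\<in>I. (\<lambda>\<omega>. (X i \<omega>, Y i \<omega>)) -` (A (i, True) \<times> A (i, False)) \<inter> space M)"
      by (auto simp: UNIV_bool)
    then have "prob (\<Inter>j\<in>I \<times> UNIV. (case j of (i, b) \<Rightarrow> if b then X i else Y i) -` A j \<inter> space M)
      = (\<Prod>i\<in>I. prob ((\<lambda>\<omega>. (X i \<omega>, Y i \<omega>)) -` (A (i, True) \<times> A (i, False)) \<inter> space M))"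
      using indep_varsD_finite[OF joint I(2,1), of "\<lambda>i. A (i, True) \<times> A (i, False)"] A' by simp
    also have "\<dots> = (\<Prod>i\<in>I. prob (X i -` A (i, True) \<inter> space M) * prob (Y i -` A (i, False) \<inter> space M))"
      by (intro prod.cong refl indep_varD[OF pair] A')
    also have "\<dots> = (\<Prod>i\<in>I. \<Prod>b\<in>UNIV. prob ((case (i, b) of (i, b) \<Rightarrow> if b then X i else Y i) -` A (i, b) \<inter> space M))"
      by (simp add: UNIV_bool mult.commute)
    also have "\<dots> = (\<Prod>j\<in>I \<times> UNIV. prob ((case j of (i, b) \<Rightarrow> if b then X i else Y i) -` A j \<inter> space M))"
      by (subst prod.cartesian_product) (auto intro!: prod.cong)
    finally show "prob (\<Inter>j\<in>I \<times> UNIV. (case j of (i, b) \<Rightarrow> if b then X i else Y i) -` A j \<inter> space M) =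
      (\<Prod>j\<in>I \<times> UNIV. prob ((case j of (i, b) \<Rightarrow> if b then X i else Y i) -` A j \<inter> space M))" .
  qed
qed (use I in \<open>auto simp: sets.sigma_sets_eq[of borel, simplified] sets.Int_stable
    intro: sets.sigma_sets_eq[of "borel::'b measure", symmetric, simplified]\<close>)

lemma distr_pair_measure_snd:
  assumes "prob_space N" "sigma_finite_measure M"
  shows "distr (N \<Otimes>\<^sub>M M) M snd = M"
proof (rule measure_eqI)
  interpret N: prob_space N by fact
  interpret M: sigma_finite_measure M by fact
  fix A assume "A \<in> sets (distr (N \<Otimes>\<^sub>M M) M snd)"
  then have A: "A \<in> sets M" by simp
  have "emeasure (distr (N \<Otimes>\<^sub>M M) M snd) A = emeasure (N \<Otimes>\<^sub>M M) (space N \<times> A)"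
    using A sets.sets_into_space[OF A]
    by (subst emeasure_distr) (auto simp: space_pair_measure intro!: arg_cong2[where f=emeasure])
  then show "emeasure (distr (N \<Otimes>\<^sub>M M) M snd) A = emeasure M A"
    using A by (simp add: M.emeasure_pair_measure_Times N.emeasure_space_1)
qed simp

text \<open>The pair \<open>(S, E)\<close> is the image of \<open>(X, Y)\<close> under the
  regression map, so its law is a product measure; independence and both marginals are read off from
  the factors.\<close>

lemma (in prob_space) complex_normal_regression_indep:
  fixes \<alpha> :: complex
  assumes ind: "indep_var borel X borel Y"
    and X: "distr M borel X = complex_normal A" and Y: "distr M borel Y = complex_normal B"
    and A: "0 < A" and B: "0 < B"
  defines "k \<equiv> (cmod \<alpha>)\<^sup>2 * A + B"
  defines "S \<equiv> \<lambda>\<omega>. \<alpha> * X \<omega> + Y \<omega>"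
  defines "E \<equiv> \<lambda>\<omega>. X \<omega> - cnj \<alpha> * of_real (A / k) * S \<omega>"
  shows "indep_var borel S borel E" "distr M borel S = complex_normal k"
    "distr M borel E = complex_normal (A * B / k)"
proof -
  have k: "0 < k" using A B by (simp add: k_def add_nonneg_pos)
  have [measurable]: "random_variable borel X" "random_variable borel Y"
    using indep_var_rv1[OF ind] indep_var_rv2[OF ind] by auto
  have rv[measurable]: "random_variable borel S" "random_variable borel E"
    by (simp_all add: S_def E_def)
  let ?T = "\<lambda>(x, y). (\<alpha> * x + y, x - cnj \<alpha> * of_real (A / k) * (\<alpha> * x + y))"
  have "distr M (borel \<Otimes>\<^sub>M borel) (\<lambda>\<omega>. (S \<omega>, E \<omega>))
    = distr (distr M (borel \<Otimes>\<^sub>M borel) (\<lambda>\<omega>. (X \<omega>, Y \<omega>))) (borel \<Otimes>\<^sub>M borel) ?T"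
    by (subst distr_distr) (auto simp: S_def E_def comp_def)
  also have "distr M (borel \<Otimes>\<^sub>M borel) (\<lambda>\<omega>. (X \<omega>, Y \<omega>)) = complex_normal A \<Otimes>\<^sub>M complex_normal B"
    using ind unfolding indep_var_distribution_eq X Y by simp
  also have "distr (complex_normal A \<Otimes>\<^sub>M complex_normal B) (borel \<Otimes>\<^sub>M borel) ?T
    = complex_normal k \<Otimes>\<^sub>M complex_normal (A * B / k)"
    unfolding k_def by (rule complex_normal_regression[OF A B])
  finally have SE: "distr M (borel \<Otimes>\<^sub>M borel) (\<lambda>\<omega>. (S \<omega>, E \<omega>)) = complex_normal k \<Otimes>\<^sub>M complex_normal (A * B / k)" .
  interpret Nk: prob_space "complex_normal k" using k by (rule prob_space_complex_normal)
  interpret Nv: prob_space "complex_normal (A * B / k)"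
    using A B k by (intro prob_space_complex_normal) simp
  have "distr M borel S = distr (distr M (borel \<Otimes>\<^sub>M borel) (\<lambda>\<omega>. (S \<omega>, E \<omega>))) borel fst"
    by (subst distr_distr) (auto simp: comp_def)
  also have "\<dots> = distr (complex_normal k \<Otimes>\<^sub>M complex_normal (A * B / k)) (complex_normal k) fst"
    unfolding SE by (intro distr_cong) auto
  finally show S: "distr M borel S = complex_normal k" by (simp add: Nv.distr_pair_fst)
  have "distr M borel E = distr (distr M (borel \<Otimes>\<^sub>M borel) (\<lambda>\<omega>. (S \<omega>, E \<omega>))) borel snd"
    by (subst distr_distr) (auto simp: comp_def)
  also have "\<dots> = distr (complex_normal k \<Otimes>\<^sub>M complex_normal (A * B / k)) (complex_normal (A * B / k)) snd"
    unfolding SE by (intro distr_cong) auto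
  finally show E: "distr M borel E = complex_normal (A * B / k)"
    by (simp add: distr_pair_measure_snd Nk.prob_space_axioms Nv.sigma_finite_measure_axioms)
  show "indep_var borel S borel E"
    unfolding indep_var_distribution_eq S E SE using rv by simp
qed

lemma (in prob_space) indep_var_linear_combination:
  fixes X :: "'i \<Rightarrow> 'a \<Rightarrow> complex"
  assumes I: "finite I" "i \<notin> I" and ind: "indep_vars (\<lambda>_. borel) X (insert i I)"
  shows "indep_var borel (X i) borel (\<lambda>\<omega>. \<Sum>k\<in>I. c k * X k \<omega>)"
proof -
  have "indep_var borel ((\<lambda>f. f i) \<circ> (\<lambda>\<omega>. restrict (\<lambda>i. X i \<omega>) {i}))
    borel ((\<lambda>f. \<Sum>k\<in>I. c k * f k) \<circ> (\<lambda>\<omega>. restrict (\<lambda>i. X i \<omega>) I))"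
    using I by (intro indep_var_compose[OF indep_var_restrict[OF ind]]) auto
  then show ?thesis by (simp add: comp_def cong: sum.cong)
qed

text \<open>Induction over the terms: adding one is the first marginal of the regression with A = 1.
  Positivity of the total weight excludes the zero combination, whose law is a point mass.\<close>

lemma (in prob_space) complex_normal_linear_combination:
  fixes X :: "'i \<Rightarrow> 'a \<Rightarrow> complex"
  assumes "finite K" "indep_vars (\<lambda>_. borel) X K" "\<And>k. k \<in> K \<Longrightarrow> distr M borel (X k) = complex_normal 1"
    and "0 < (\<Sum>k\<in>K. (cmod (c k))\<^sup>2)"
  shows "distr M borel (\<lambda>\<omega>. \<Sum>k\<in>K. c k * X k \<omega>) = complex_normal (\<Sum>k\<in>K. (cmod (c k))\<^sup>2)"
  using assms
proof (induction K rule: finite_induct)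
  case empty
  then show ?case by simp
next
  case (insert i K)
  have [measurable]: "random_variable borel (X i)"
    using insert.prems(1) by (auto simp: indep_vars_def)
  show ?case
  \<comment> \<open>If all earlier weights vanish, the partial sum is constantly 0 and the induction
    hypothesis does not apply; only the scaling of \<open>X i\<close> remains, and then
    \<open>c i\<close> is nonzero.\<close>
  proof (cases "\<forall>k\<in>K. c k = 0")
    case True
    have "distr M borel (\<lambda>\<omega>. c i * X i \<omega>) = distr (distr M borel (X i)) borel ((*) (c i))"
      by (subst distr_distr) (auto simp: comp_def)
    also have "\<dots> = complex_normal ((cmod (c i))\<^sup>2)"
      using insert True distr_complex_normal_mult[of 1 "c i"] by simp
    finally show ?thesis using insert.hyps True by simp
  next
    case False
    then have pos: "0 < (\<Sum>k\<in>K. (cmod (c k))\<^sup>2)"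
      using insert.hyps by (auto intro!: sum_pos2)
    have "distr M borel (\<lambda>\<omega>. \<Sum>k\<in>K. c k * X k \<omega>) = complex_normal (\<Sum>k\<in>K. (cmod (c k))\<^sup>2)"
      using insert.prems pos by (intro insert.IH) (auto intro: indep_vars_subset)
    from complex_normal_regression_indep(2)[OF indep_var_linear_combination[OF insert.hyps insert.prems(1)]
        _ this zero_less_one pos, of "c i"]
    show ?thesis using insert.prems(2) insert.hyps by simp
  qed
qed

text \<open>Passage from coordinates to the plane: by independence the joint density is the product
  of two real normal densities, which is the complex density with v = 1.\<close>

lemma (in prob_space) std_complex_normal_imp_distr:
  assumes "std_complex_normal M X"
  shows "random_variable borel X" "distr M borel X = complex_normal 1"
proof -
  have ind: "indep_var borel (\<lambda>\<omega>. Re (X \<omega>)) borel (\<lambda>\<omega>. Im (X \<omega>))"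
    and re: "distributed M lborel (\<lambda>\<omega>. Re (X \<omega>)) (normal_density 0 (sqrt (1/2)))"
    and im: "distributed M lborel (\<lambda>\<omega>. Im (X \<omega>)) (normal_density 0 (sqrt (1/2)))"
    using assms by (auto simp: std_complex_normal_def)
  have [measurable]: "random_variable borel (\<lambda>\<omega>. Re (X \<omega>))" "random_variable borel (\<lambda>\<omega>. Im (X \<omega>))"
    using indep_var_rv1[OF ind] indep_var_rv2[OF ind] by auto
  then show [measurable]: "random_variable borel X" by (simp add: borel_measurable_complex_iff)
  have "indep_var lborel (\<lambda>\<omega>. Re (X \<omega>)) lborel (\<lambda>\<omega>. Im (X \<omega>))"
    using indep_var_compose[OF ind, of "\<lambda>x. x" lborel "\<lambda>x. x" lborel] by (simp add: comp_def)
  then have D: "distributed M (lborel \<Otimes>\<^sub>M lborel) (\<lambda>\<omega>. (Re (X \<omega>), Im (X \<omega>)))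
    (\<lambda>(x, y). ennreal (normal_density 0 (sqrt (1/2)) x) * ennreal (normal_density 0 (sqrt (1/2)) y))"
    by (intro distributed_joint_indep re im lborel.sigma_finite_measure_axioms)
  show "distr M borel X = complex_normal 1"
  proof (rule measure_eqI)
    fix Q assume "Q \<in> sets (distr M borel X)"
    then have [measurable]: "Q \<in> sets borel" by simp
    have "emeasure (complex_normal 1) Q = (\<integral>\<^sup>+z. ennreal (complex_normal_density 1 z) * indicator Q z \<partial>lborel)"
      by (simp add: complex_normal_def emeasure_density)
    also have "\<dots> = (\<integral>\<^sup>+p. (case p of (x, y) \<Rightarrow> ennreal (normal_density 0 (sqrt (1/2)) x) * ennreal (normal_density 0 (sqrt (1/2)) y)) *
       (case p of (x, y) \<Rightarrow> indicator Q (Complex x y)) \<partial>(lborel \<Otimes>\<^sub>M lborel))"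
      by (subst nn_integral_complex, measurable, subst lborel.nn_integral_fst[symmetric])
         (auto simp: complex_normal_density_Complex ennreal_mult)
    also have "\<dots> = (\<integral>\<^sup>+\<omega>. indicator Q (X \<omega>) \<partial>M)"
      by (subst distributed_nn_integral[OF D]) auto
    also have "\<dots> = emeasure (distr M borel X) Q"
      by (subst nn_integral_distr[symmetric, of X M borel "indicator Q"]) auto
    finally show "emeasure (distr M borel X) Q = emeasure (complex_normal 1) Q" by simp
  qed simp
qed

section \<open>Beamforming along a Gaussian vector\<close>

text \<open>Applied with \<open>Z\<close> listing all entries of \<open>S\<close> and
  \<open>E\<close>: one entry is split off from any expression in all the others.\<close>

lemma (in prob_space) indep_var_rest:
  assumes ind: "indep_vars (\<lambda>_. borel) Z I" and i: "i \<in> I"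
    and f: "f \<in> measurable (PiM (I - {i}) (\<lambda>_. borel)) borel"
  shows "indep_var borel (Z i) borel (\<lambda>\<omega>. f (restrict (\<lambda>j. Z j \<omega>) (I - {i})))"
proof -
  have "indep_var borel ((\<lambda>g. g i) \<circ> (\<lambda>\<omega>. restrict (\<lambda>j. Z j \<omega>) {i}))
    borel (f \<circ> (\<lambda>\<omega>. restrict (\<lambda>j. Z j \<omega>) (I - {i})))"
    using i by (intro indep_var_compose[OF indep_var_restrict[OF ind]] f) auto
  then show ?thesis by (simp add: comp_def)
qed

lemma (in prob_space) indep_vars_rv:
  "indep_vars N X I \<Longrightarrow> i \<in> I \<Longrightarrow> random_variable (N i) (X i)"
  by (simp add: indep_vars_def)

text \<open>The direction depends on \<open>S\<close> alone. Instead of conditioning on it, every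
  moment is expanded until each summand either contains some \<open>E m\<close> as an isolated
  factor, independent of the rest and of mean 0, or is a product of squared moduli.\<close>

lemma (in prob_space) beamforming_moments:
  fixes S E :: "nat \<Rightarrow> 'a \<Rightarrow> complex" and \<gamma> :: complex
  assumes n: "1 \<le> n" and s: "0 < s" and v: "0 < v"
    and ind: "indep_vars (\<lambda>_. borel) (\<lambda>(m, b). if b then S m else E m) ({..<n} \<times> UNIV)"
    and S: "\<And>m. m < n \<Longrightarrow> distr M borel (S m) = complex_normal s"
    and E: "\<And>m. m < n \<Longrightarrow> distr M borel (E m) = complex_normal v"
  defines "R \<equiv> \<lambda>\<omega>. sqrt (\<Sum>m<n. (cmod (S m \<omega>))\<^sup>2)"
  defines "G \<equiv> \<lambda>\<omega>. \<Sum>m<n. (\<gamma> * S m \<omega> + E m \<omega>) * (cnj (S m \<omega>) / of_real (R \<omega>))"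
  shows "integrable M G" "expectation G = \<gamma> * of_real (sqrt s * (Gamma (real n + 1/2) / Gamma (real n)))"
    "integrable M (\<lambda>\<omega>. (cmod (G \<omega>))\<^sup>2)" "expectation (\<lambda>\<omega>. (cmod (G \<omega>))\<^sup>2) = (cmod \<gamma>)\<^sup>2 * (n * s) + v"
proof -
  let ?I = "{..<n} \<times> (UNIV :: bool set)"
  let ?Z = "\<lambda>(m, b). if b then S m else E m"
  have rvS[measurable]: "random_variable borel (S m)" if "m < n" for m
    using indep_vars_rv[OF ind, of "(m, True)"] that by simp
  have rvE[measurable]: "random_variable borel (E m)" if "m < n" for m
    using indep_vars_rv[OF ind, of "(m, False)"] that by simp
  have rvR[measurable]: "random_variable borel R"
    unfolding R_def by measurable
  have indS: "indep_vars (\<lambda>_. borel) S {..<n}"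
    using indep_vars_reindex[OF indep_vars_subset[OF ind], of "\<lambda>m. (m, True)" "{..<n}"]
    by (auto simp: inj_on_def)
  have norm_S: "integrable M R" "expectation R = sqrt s * (Gamma (real n + 1/2) / Gamma (real n))"
    "integrable M (\<lambda>\<omega>. (R \<omega>)\<^sup>2)" "expectation (\<lambda>\<omega>. (R \<omega>)\<^sup>2) = n * s"
    "AE \<omega> in M. R \<omega> > 0"
    unfolding R_def by (rule complex_normal_norm_moments[OF indS S s n]; assumption)+
  have R_nonneg: "0 \<le> R \<omega>" for \<omega> by (simp add: R_def sum_nonneg)
  have R2: "(R \<omega>)\<^sup>2 = (\<Sum>m<n. (cmod (S m \<omega>))\<^sup>2)" for \<omega> by (simp add: R_def sum_nonneg)
  have S_le_R: "cmod (S m \<omega>) \<le> R \<omega>" if "m < n" for m \<omega>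
  proof -
    have "(cmod (S m \<omega>))\<^sup>2 \<le> (\<Sum>m<n. (cmod (S m \<omega>))\<^sup>2)"
      using that by (intro member_le_sum) auto
    then show ?thesis unfolding R_def by (rule real_le_rsqrt)
  qed
  \<comment> \<open>Where \<open>R\<close> vanishes, division by zero makes \<open>a\<close> zero as
    well; since all \<open>S m\<close> are then zero too, the bounds and the products with
    \<open>R\<close> and \<open>S\<close> below hold at every point.\<close>
  define a where "a = (\<lambda>m \<omega>. cnj (S m \<omega>) / of_real (R \<omega>))"
  have rva[measurable]: "random_variable borel (a m)" if "m < n" for m
    using that unfolding a_def by measurable
  have a_le: "cmod (a m \<omega>) \<le> 1" if "m < n" for m \<omega>
    using S_le_R[OF that] R_nonneg[of \<omega>] by (cases "R \<omega> = 0") (auto simp: a_def norm_divide divide_le_eq_1)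
  have Ra: "of_real (R \<omega>) * a m \<omega> = cnj (S m \<omega>)" if "m < n" for m \<omega>
    using S_le_R[OF that, of \<omega>] by (auto simp: a_def)
  have sum_Sa: "(\<Sum>m<n. S m \<omega> * a m \<omega>) = of_real (R \<omega>)" for \<omega>
  proof (cases "R \<omega> = 0")
    case False
    have "(\<Sum>m<n. S m \<omega> * a m \<omega>) = of_real (\<Sum>m<n. (cmod (S m \<omega>))\<^sup>2) / of_real (R \<omega>)"
      by (simp add: a_def sum_divide_distrib complex_norm_square[symmetric] del: of_real_power)
    also have "\<dots> = of_real (R \<omega>)"
      unfolding R2[symmetric] using False by (simp add: power2_eq_square)
    finally show ?thesis .
  qed (simp add: a_def)
  \<comment> \<open>The component of \<open>E\<close> along the direction; what is left of
    \<open>G\<close> is \<gamma> times the norm \<open>R\<close>.\<close>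
  define T where "T = (\<lambda>\<omega>. \<Sum>m<n. E m \<omega> * a m \<omega>)"
  have G_T: "G \<omega> = \<gamma> * of_real (R \<omega>) + T \<omega>" for \<omega>
  proof -
    have "G \<omega> = (\<Sum>m<n. \<gamma> * (S m \<omega> * a m \<omega>) + E m \<omega> * a m \<omega>)"
      by (simp add: G_def a_def add_divide_distrib distrib_right mult.assoc)
    then show ?thesis by (simp add: sum.distrib T_def sum_distrib_left[symmetric] sum_Sa)
  qed
  have rvT[measurable]: "random_variable borel T" unfolding T_def by measurable
  note momE = complex_normal_moments[OF rvE E v]
  note momS = complex_normal_moments[OF rvS S s]
  \<comment> \<open>The same direction as a function on the product space of all coordinates except
    one \<open>E m\<close>, the form that \<open>indep_var_rest\<close> asks for.\<close>
  define a' where "a' = (\<lambda>m f. cnj (f (m, True)) / complex_of_real (sqrt (\<Sum>k<n. (cmod (f (k, True)))\<^sup>2)))"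
  have comp[measurable]: "(\<lambda>f. f (k, True)) \<in> measurable (PiM (?I - {(m, False)}) (\<lambda>_. borel)) borel"
    if "k < n" for m k
    using that by (intro measurable_component_singleton) auto
  have comp'[measurable]: "(\<lambda>f. f (k, False)) \<in> measurable (PiM (?I - {(m, False)}) (\<lambda>_. borel)) borel"
    if "k < n" "k \<noteq> m" for m k
    using that by (intro measurable_component_singleton) auto
  have a'[measurable]: "a' k \<in> measurable (PiM (?I - {(m, False)}) (\<lambda>_. borel)) borel" if "k < n" for m k
    using that unfolding a'_def by measurable
  have a'_eq: "a' k (restrict (\<lambda>j. ?Z j \<omega>) (?I - {(m, False)})) = a k \<omega>" if "k < n" for m k \<omega>
    using that by (simp add: a'_def a_def R_def)
  have indE: "indep_var borel (E m) borel (\<lambda>\<omega>. f (restrict (\<lambda>j. ?Z j \<omega>) (?I - {(m, False)})))"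
    if "m < n" "f \<in> measurable (PiM (?I - {(m, False)}) (\<lambda>_. borel)) borel" for m and f :: "_ \<Rightarrow> complex"
    using indep_var_rest[OF ind, of "(m, False)" f] that by simp
  have Ea: "integrable M (\<lambda>\<omega>. E m \<omega> * a m \<omega>)" "expectation (\<lambda>\<omega>. E m \<omega> * a m \<omega>) = 0" if m: "m < n" for m
  proof -
    have i: "indep_var borel (E m) borel (a m)"
      using indE[OF m a'[OF m]] by (simp add: a'_eq m)
    have ia: "integrable M (a m)"
      using m a_le by (intro integrable_const_bound[where B=1]) auto
    show "integrable M (\<lambda>\<omega>. E m \<omega> * a m \<omega>)" "expectation (\<lambda>\<omega>. E m \<omega> * a m \<omega>) = 0"
      using indep_var_integrable[OF i _ ia] indep_var_lebesgue_integral[OF i _ ia] momE(1,2)[OF m m] by auto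
  qed
  have ET: "integrable M T" "expectation T = 0"
    unfolding T_def using Ea by (auto simp: Bochner_Integration.integral_sum)
  show "integrable M G" unfolding G_T[abs_def] using norm_S(1) ET(1) by simp
  show "expectation G = \<gamma> * of_real (sqrt s * (Gamma (real n + 1/2) / Gamma (real n)))"
    unfolding G_T[abs_def] using norm_S(1,2) ET by simp
  have ES: "integrable M (\<lambda>\<omega>. E m \<omega> * cnj (S m \<omega>))" "expectation (\<lambda>\<omega>. E m \<omega> * cnj (S m \<omega>)) = 0" if m: "m < n" for m
  proof -
    have i: "indep_var borel (E m) borel (\<lambda>\<omega>. cnj (S m \<omega>))"
      using indE[of m "\<lambda>f. cnj (f (m, True))"] m by simp
    have iS: "integrable M (\<lambda>\<omega>. cnj (S m \<omega>))" using momS(1)[OF m m] by simp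
    show "integrable M (\<lambda>\<omega>. E m \<omega> * cnj (S m \<omega>))" "expectation (\<lambda>\<omega>. E m \<omega> * cnj (S m \<omega>)) = 0"
      using indep_var_integrable[OF i _ iS] indep_var_lebesgue_integral[OF i _ iS] momE(1,2)[OF m m] by auto
  qed
  \<comment> \<open>Multiplying by \<open>R\<close> removes the normalisation: the cross term
    becomes bilinear in \<open>E\<close> and \<open>S\<close>, so its mean factors entry by
    entry.\<close>
  have RT_eq: "of_real (R \<omega>) * T \<omega> = (\<Sum>m<n. E m \<omega> * cnj (S m \<omega>))" for \<omega>
    using Ra by (simp add: T_def sum_distrib_left mult.left_commute)
  have RT: "integrable M (\<lambda>\<omega>. of_real (R \<omega>) * T \<omega>)" "expectation (\<lambda>\<omega>. of_real (R \<omega>) * T \<omega>) = 0"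
    unfolding RT_eq using ES by (auto simp: Bochner_Integration.integral_sum)
  \<comment> \<open>Off-diagonal terms of |T|^2: \<open>E m\<close> is independent of the remaining
    factor, which is integrable because it is dominated by |E k|.\<close>
  have EE: "integrable M (\<lambda>\<omega>. E m \<omega> * (a m \<omega> * cnj (E k \<omega> * a k \<omega>)))"
      "expectation (\<lambda>\<omega>. E m \<omega> * (a m \<omega> * cnj (E k \<omega> * a k \<omega>))) = 0" if m: "m < n" and k: "k < n" "m \<noteq> k" for m k
  proof -
    have i: "indep_var borel (E m) borel (\<lambda>\<omega>. a m \<omega> * cnj (E k \<omega> * a k \<omega>))"
      using indE[of m "\<lambda>f. a' m f * cnj (f (k, False) * a' k f)"] m k by (simp add: a'_eq)
    have ib: "integrable M (\<lambda>\<omega>. a m \<omega> * cnj (E k \<omega> * a k \<omega>))"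
    proof (rule Bochner_Integration.integrable_bound[OF momE(1)[OF k(1) k(1)]])
      have "norm (a m \<omega>) * (norm (E k \<omega>) * norm (a k \<omega>)) \<le> 1 * (norm (E k \<omega>) * 1)" for \<omega>
        using a_le[OF m] a_le[OF k(1)] by (intro mult_mono) auto
      then show "AE \<omega> in M. norm (a m \<omega> * cnj (E k \<omega> * a k \<omega>)) \<le> norm (E k \<omega>)"
        by (simp add: norm_mult)
    qed (use m k in measurable)
    show "integrable M (\<lambda>\<omega>. E m \<omega> * (a m \<omega> * cnj (E k \<omega> * a k \<omega>)))"
      "expectation (\<lambda>\<omega>. E m \<omega> * (a m \<omega> * cnj (E k \<omega> * a k \<omega>))) = 0"
      using indep_var_integrable[OF i _ ib] indep_var_lebesgue_integral[OF i _ ib] momE(1,2)[OF m m] by auto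
  qed
  have a2_int: "integrable M (\<lambda>\<omega>. complex_of_real ((cmod (a m \<omega>))\<^sup>2))" if m: "m < n" for m
    using m a_le[OF m] by (intro integrable_const_bound[where B=1]) (auto simp: norm_power abs_square_le_1)
  \<comment> \<open>Diagonal terms: the product equals |E m|^2 |a m|^2, with independent
    factors.\<close>
  have EE1: "integrable M (\<lambda>\<omega>. E m \<omega> * (a m \<omega> * cnj (E m \<omega> * a m \<omega>)))"
      "expectation (\<lambda>\<omega>. E m \<omega> * (a m \<omega> * cnj (E m \<omega> * a m \<omega>))) = v * expectation (\<lambda>\<omega>. complex_of_real ((cmod (a m \<omega>))\<^sup>2))" if m: "m < n" for m
  proof -
    have "indep_var borel ((\<lambda>z. complex_of_real ((cmod z)\<^sup>2)) \<circ> E m) borel ((\<lambda>z. complex_of_real ((cmod z)\<^sup>2)) \<circ> a m)"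
      using indE[OF m a'[OF m]] by (intro indep_var_compose) (auto simp: a'_eq m)
    then have i: "indep_var borel (\<lambda>\<omega>. complex_of_real ((cmod (E m \<omega>))\<^sup>2)) borel (\<lambda>\<omega>. complex_of_real ((cmod (a m \<omega>))\<^sup>2))"
      by (simp add: comp_def)
    have eq: "E m \<omega> * (a m \<omega> * cnj (E m \<omega> * a m \<omega>)) = complex_of_real ((cmod (E m \<omega>))\<^sup>2) * complex_of_real ((cmod (a m \<omega>))\<^sup>2)" for \<omega>
      unfolding complex_norm_square by simp
    have iE: "integrable M (\<lambda>\<omega>. complex_of_real ((cmod (E m \<omega>))\<^sup>2))"
      "expectation (\<lambda>\<omega>. complex_of_real ((cmod (E m \<omega>))\<^sup>2)) = v"
      using momE(3,4)[OF m m] by (auto simp del: of_real_power)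
    show "integrable M (\<lambda>\<omega>. E m \<omega> * (a m \<omega> * cnj (E m \<omega> * a m \<omega>)))"
      "expectation (\<lambda>\<omega>. E m \<omega> * (a m \<omega> * cnj (E m \<omega> * a m \<omega>))) = v * expectation (\<lambda>\<omega>. complex_of_real ((cmod (a m \<omega>))\<^sup>2))"
      unfolding eq using indep_var_integrable[OF i iE(1) a2_int[OF m]] indep_var_lebesgue_integral[OF i iE(1) a2_int[OF m]] iE(2)
      by auto
  qed
  have T2_eq: "complex_of_real ((cmod (T \<omega>))\<^sup>2) = (\<Sum>m<n. \<Sum>k<n. E m \<omega> * (a m \<omega> * cnj (E k \<omega> * a k \<omega>)))" for \<omega>
    unfolding complex_norm_square T_def cnj_sum sum_product by (simp add: mult.assoc)
  \<comment> \<open>Only almost surely: the sum is 0 on the null event where \<open>R\<close>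
    vanishes.\<close>
  have sum_a2: "AE \<omega> in M. (\<Sum>m<n. complex_of_real ((cmod (a m \<omega>))\<^sup>2)) = 1"
    using norm_S(5)
  proof eventually_elim
    case (elim \<omega>)
    then have "(\<Sum>m<n. (cmod (a m \<omega>))\<^sup>2) = (\<Sum>m<n. (cmod (S m \<omega>))\<^sup>2) / (R \<omega>)\<^sup>2"
      by (simp add: a_def norm_divide power_divide sum_divide_distrib)
    also have "\<dots> = 1" using elim by (simp add: R2[symmetric])
    finally show ?case by (metis of_real_1 of_real_sum)
  qed
  have T2: "integrable M (\<lambda>\<omega>. complex_of_real ((cmod (T \<omega>))\<^sup>2))"
    "expectation (\<lambda>\<omega>. complex_of_real ((cmod (T \<omega>))\<^sup>2)) = v"
  proof -
    have int: "integrable M (\<lambda>\<omega>. E m \<omega> * (a m \<omega> * cnj (E k \<omega> * a k \<omega>)))" if "m < n" "k < n" for m k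
      using EE(1)[of m k] EE1(1)[of m] that by (cases "m = k") auto
    show "integrable M (\<lambda>\<omega>. complex_of_real ((cmod (T \<omega>))\<^sup>2))"
      unfolding T2_eq by (intro Bochner_Integration.integrable_sum int) auto
    have "expectation (\<lambda>\<omega>. complex_of_real ((cmod (T \<omega>))\<^sup>2))
      = (\<Sum>m<n. \<Sum>k<n. expectation (\<lambda>\<omega>. E m \<omega> * (a m \<omega> * cnj (E k \<omega> * a k \<omega>))))"
      unfolding T2_eq using int
      by (subst Bochner_Integration.integral_sum, force)
         (intro sum.cong refl Bochner_Integration.integral_sum, auto)
    also have "\<dots> = (\<Sum>m<n. \<Sum>k<n. if m = k then v * expectation (\<lambda>\<omega>. complex_of_real ((cmod (a m \<omega>))\<^sup>2)) else 0)"
      using EE(2) EE1(2) by (intro sum.cong refl) auto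
    also have "\<dots> = (\<Sum>m<n. v * expectation (\<lambda>\<omega>. complex_of_real ((cmod (a m \<omega>))\<^sup>2)))"
      by (intro sum.cong refl) (simp del: of_real_power)
    also have "\<dots> = v * expectation (\<lambda>\<omega>. \<Sum>m<n. complex_of_real ((cmod (a m \<omega>))\<^sup>2))"
      using a2_int by (subst Bochner_Integration.integral_sum) (auto simp: sum_distrib_left)
    also have "expectation (\<lambda>\<omega>. \<Sum>m<n. complex_of_real ((cmod (a m \<omega>))\<^sup>2)) = expectation (\<lambda>\<omega>. 1)"
      using sum_a2 by (intro integral_cong_AE) auto
    finally show "expectation (\<lambda>\<omega>. complex_of_real ((cmod (T \<omega>))\<^sup>2)) = v" by (simp add: prob_space)
  qed
  have G2_eq: "(cmod (G \<omega>))\<^sup>2 = (cmod \<gamma>)\<^sup>2 * (R \<omega>)\<^sup>2 + 2 * Re (cnj \<gamma> * (of_real (R \<omega>) * T \<omega>)) + Re (complex_of_real ((cmod (T \<omega>))\<^sup>2))" for \<omega>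
    unfolding G_T Re_complex_of_real cmod_power2 by (simp add: power2_eq_square algebra_simps)
  have int2: "integrable M (\<lambda>\<omega>. 2 * Re (cnj \<gamma> * (of_real (R \<omega>) * T \<omega>)))"
    "expectation (\<lambda>\<omega>. 2 * Re (cnj \<gamma> * (of_real (R \<omega>) * T \<omega>))) = 0"
    using RT by (simp_all del: times_complex.sel)
  show "integrable M (\<lambda>\<omega>. (cmod (G \<omega>))\<^sup>2)"
    unfolding G2_eq using norm_S(3) int2(1) T2(1)
    by (intro Bochner_Integration.integrable_add integrable_Re) auto
  have "expectation (\<lambda>\<omega>. (cmod (G \<omega>))\<^sup>2) = (cmod \<gamma>)\<^sup>2 * expectation (\<lambda>\<omega>. (R \<omega>)\<^sup>2) + 0
      + Re (expectation (\<lambda>\<omega>. complex_of_real ((cmod (T \<omega>))\<^sup>2)))"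
    unfolding G2_eq using norm_S(3) int2 integrable_Re[OF T2(1)] integral_Re[OF T2(1)]
    by (subst Bochner_Integration.integral_add; (subst Bochner_Integration.integral_add)?; simp del: Re_complex_of_real times_complex.sel)
  then show "expectation (\<lambda>\<omega>. (cmod (G \<omega>))\<^sup>2) = (cmod \<gamma>)\<^sup>2 * (n * s) + v"
    by (simp only: norm_S(4) T2(2) Re_complex_of_real)
qed

section \<open>The MMSE estimate and the gain of one base station\<close>

text \<open>For a unit vector, \<open>outer_self \<psi>\<close> is a projection, and
  \<open>hermitian \<psi>\<close> is a left eigenvector of the matrix with eigenvalue 1 + c. It is
  therefore an eigenvector of the inverse for the reciprocal.\<close>

lemma hermitian_matrix_inv_rank_one:
  fixes \<psi> :: "complex ^ 't::finite"
  assumes unit: "(\<Sum>t\<in>UNIV. hermitian \<psi> $ t * \<psi> $ t) = 1" and k: "1 + r * (\<Sum>i\<in>UNIV. b i) \<noteq> (0::real)"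
  shows "hermitian \<psi> v* matrix_inv (mat 1 + r *\<^sub>R (\<Sum>i\<in>UNIV. b i *\<^sub>R outer_self \<psi>))
    = (1 / (1 + r * (\<Sum>i\<in>UNIV. b i))) *\<^sub>R hermitian \<psi>"
proof -
  define c where "c = r * (\<Sum>i\<in>UNIV. b i)"
  \<comment> \<open>Solves c - d - c d = 0, so that (1 + c O)(1 - d O) = 1 when O O = O: the
    rank-one inverse of Sherman and Morrison.\<close>
  define d where "d = c / (1 + c)"
  let ?O = "outer_self \<psi>"
  let ?N = "mat 1 + c *\<^sub>R ?O"
  let ?N' = "mat 1 - d *\<^sub>R ?O"
  have unit': "(\<Sum>t\<in>UNIV. cnj (\<psi> $ t) * \<psi> $ t) = 1"
    using unit by (simp add: hermitian_def)
  have OO: "?O ** ?O = ?O"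
  proof -
    have "(\<Sum>k\<in>UNIV. \<psi> $ s * cnj (\<psi> $ k) * (\<psi> $ k * cnj (\<psi> $ t)))
      = \<psi> $ s * cnj (\<psi> $ t) * (\<Sum>k\<in>UNIV. cnj (\<psi> $ k) * \<psi> $ k)" for s t
      unfolding sum_distrib_left by (intro sum.cong) auto
    then show ?thesis
      by (simp add: vec_eq_iff matrix_matrix_mult_def outer_self_def hermitian_def unit')
  qed
  have scale: "(x *\<^sub>R A) ** B = x *\<^sub>R (A ** B)" "A ** (x *\<^sub>R B) = x *\<^sub>R (A ** B)"
    for x and A B :: "complex ^ 't ^ 't"
    by (simp_all add: vec_eq_iff matrix_matrix_mult_def scaleR_sum_right)
  have dist: "(A + B) ** C = A ** C + B ** C" "A ** (B - C) = A ** B - A ** C" "(A - B) ** C = A ** C - B ** C" "A ** (B + C) = A ** B + A ** C"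
    for A B C :: "complex ^ 't ^ 't"
    by (simp_all add: vec_eq_iff matrix_matrix_mult_def sum.distrib sum_subtractf algebra_simps)
  have cd: "c - d - c * d = 0" using k by (simp add: d_def c_def field_simps)
  have "?N ** ?N' = mat 1 + (c - d - c * d) *\<^sub>R ?O" "?N' ** ?N = mat 1 + (c - d - c * d) *\<^sub>R ?O"
    by (simp_all add: dist scale OO scaleR_diff_left mult.commute algebra_simps)
  then have "?N ** ?N' = mat 1" "?N' ** ?N = mat 1"
    by (simp_all add: cd)
  \<comment> \<open>\<open>matrix_inv\<close> is a choice among two-sided inverses, so its defining
    property is available once such an inverse is exhibited.\<close>
  then have "?N ** matrix_inv ?N = mat 1"
    unfolding matrix_inv_def by (rule someI2[where a="?N'", OF conjI]) auto
  moreover have "hermitian \<psi> v* ?N = (1 + c) *\<^sub>R hermitian \<psi>"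
  proof -
    have "hermitian \<psi> v* ?O = hermitian \<psi>"
      by (simp add: vec_eq_iff vector_matrix_mult_def outer_self_def hermitian_def
          mult.assoc[symmetric] sum_distrib_right[symmetric] unit')
    moreover have "hermitian \<psi> v* (c *\<^sub>R ?O) = c *\<^sub>R (hermitian \<psi> v* ?O)"
      by (simp add: vec_eq_iff vector_matrix_mult_def scaleR_sum_right)
    ultimately show ?thesis by (simp add: vector_matrix_mult_add_rdistrib scaleR_add_left)
  qed
  ultimately have "((1 + c) *\<^sub>R hermitian \<psi>) v* matrix_inv ?N = hermitian \<psi>"
    by (metis vector_matrix_mul_assoc vector_matrix_mul_rid)
  moreover have "((1 + c) *\<^sub>R hermitian \<psi>) v* matrix_inv ?N = (1 + c) *\<^sub>R (hermitian \<psi> v* matrix_inv ?N)"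
    by (simp add: vec_eq_iff vector_matrix_mult_def scaleR_sum_right)
  ultimately have "hermitian \<psi> v* matrix_inv ?N = (1 / (1 + c)) *\<^sub>R hermitian \<psi>"
  proof -
    assume eq: "((1 + c) *\<^sub>R hermitian \<psi>) v* matrix_inv ?N = hermitian \<psi>"
      "((1 + c) *\<^sub>R hermitian \<psi>) v* matrix_inv ?N = (1 + c) *\<^sub>R (hermitian \<psi> v* matrix_inv ?N)"
    have "hermitian \<psi> v* matrix_inv ?N = (1 / (1 + c)) *\<^sub>R ((1 + c) *\<^sub>R (hermitian \<psi> v* matrix_inv ?N))"
      using k by (simp add: c_def[symmetric])
    then show ?thesis unfolding eq(2)[symmetric] eq(1) .
  qed
  moreover have "r *\<^sub>R (\<Sum>i\<in>UNIV. b i *\<^sub>R ?O) = c *\<^sub>R ?O"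
    by (simp add: c_def scaleR_sum_left[symmetric])
  ultimately show ?thesis by (simp add: c_def)
qed

text \<open>The bracket is the same for every \<open>l'\<close>: at one base station the estimates
  for all users are parallel. This is the pilot contamination that leaves interference in the
  limit.\<close>

lemma mmse_estimate_eq:
  fixes p_r :: real and \<psi> :: "complex ^ 't::finite" and \<beta> :: "'l::finite \<Rightarrow> 'l \<Rightarrow> real"
  assumes unit: "(\<Sum>t\<in>UNIV. hermitian \<psi> $ t * \<psi> $ t) = 1"
    and pr: "0 < p_r" and \<beta>: "\<And>j l. 0 \<le> \<beta> j l"
  shows "mmse_estimate p_r \<beta> \<psi> h W l' l m \<omega>
    = of_real (sqrt (p_r * CARD('t) * \<beta> l' l) / kappa p_r CARD('t) \<beta> l) *
      ((\<Sum>j\<in>UNIV. of_real (sqrt (p_r * CARD('t) * \<beta> j l)) * h j l m \<omega>) + (\<Sum>t\<in>UNIV. cnj (\<psi> $ t) * W l m \<omega> $ t))"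
proof -
  have "0 \<le> (\<Sum>i\<in>UNIV. \<beta> i l)" using \<beta> by (intro sum_nonneg) auto
  then have k: "0 < 1 + (p_r * CARD('t)) * (\<Sum>i\<in>UNIV. \<beta> i l)"
    using pr by (intro add_pos_nonneg mult_nonneg_nonneg) auto
  have unit': "(\<Sum>t\<in>UNIV. cnj (\<psi> $ t) * \<psi> $ t) = 1"
    using unit by (simp add: hermitian_def)
  have received_t: "received p_r \<beta> \<psi> h W l m \<omega> $ t
    = \<psi> $ t * (\<Sum>j\<in>UNIV. of_real (sqrt (p_r * CARD('t) * \<beta> j l)) * h j l m \<omega>) + W l m \<omega> $ t" for t
    by (simp add: received_def real_sqrt_mult)
       (simp add: scaleR_conv_of_real sum_distrib_left mult_ac)
  have "(\<Sum>t\<in>UNIV. cnj (\<psi> $ t) * received p_r \<beta> \<psi> h W l m \<omega> $ t)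
    = (\<Sum>t\<in>UNIV. cnj (\<psi> $ t) * \<psi> $ t * (\<Sum>j\<in>UNIV. of_real (sqrt (p_r * CARD('t) * \<beta> j l)) * h j l m \<omega>)) + (\<Sum>t\<in>UNIV. cnj (\<psi> $ t) * W l m \<omega> $ t)"
    by (simp add: received_t distrib_left sum.distrib mult.assoc)
  also have "\<dots> = (\<Sum>j\<in>UNIV. of_real (sqrt (p_r * CARD('t) * \<beta> j l)) * h j l m \<omega>) + (\<Sum>t\<in>UNIV. cnj (\<psi> $ t) * W l m \<omega> $ t)"
    by (simp only: sum_distrib_right[symmetric] unit' mult_1_left)
  finally have combined: "(\<Sum>t\<in>UNIV. cnj (\<psi> $ t) * received p_r \<beta> \<psi> h W l m \<omega> $ t) = \<dots>" .
  have row: "(hermitian \<psi> v* matrix_inv (mat 1 + (p_r * CARD('t)) *\<^sub>R (\<Sum>i\<in>UNIV. \<beta> i l *\<^sub>R outer_self \<psi>))) $ t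
    = of_real (1 / kappa p_r CARD('t) \<beta> l) * cnj (\<psi> $ t)" for t
    using k by (subst hermitian_matrix_inv_rank_one[OF unit])
      (auto simp: hermitian_def kappa_def scaleR_conv_of_real[of _ "_ :: complex"])
  show ?thesis
    unfolding mmse_estimate_def row mult.assoc sum_distrib_left[symmetric] combined by simp
qed

text \<open>The channel model in abstract form: each antenna m sees unit normals
  \<open>Y (k, m)\<close> with weights \<open>c k\<close>, and \<open>k0\<close> marks the channel
  of interest. Assumption \<open>pos\<close> keeps the rest of the combination nondegenerate, as the
  regression demands.\<close>

lemma (in prob_space) combined_beamforming_moments:
  fixes Y :: "'k::finite \<times> nat \<Rightarrow> 'a \<Rightarrow> complex" and c :: "'k \<Rightarrow> complex"
  assumes n: "1 \<le> n" and ind: "indep_vars (\<lambda>_. borel) Y (UNIV \<times> {..<n})"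
    and Y: "\<And>k m. m < n \<Longrightarrow> distr M borel (Y (k, m)) = complex_normal 1"
    and pos: "0 < (\<Sum>k\<in>UNIV - {k0}. (cmod (c k))\<^sup>2)"
  defines "s \<equiv> \<Sum>k\<in>UNIV. (cmod (c k))\<^sup>2"
  defines "S \<equiv> \<lambda>m \<omega>. \<Sum>k\<in>UNIV. c k * Y (k, m) \<omega>"
  defines "G \<equiv> \<lambda>\<omega>. \<Sum>m<n. Y (k0, m) \<omega> * (cnj (S m \<omega>) / of_real (sqrt (\<Sum>m<n. (cmod (S m \<omega>))\<^sup>2)))"
  shows "integrable M G" "expectation G = cnj (c k0) * of_real (Gamma (real n + 1/2) / Gamma (real n) / sqrt s)"
    "integrable M (\<lambda>\<omega>. (cmod (G \<omega>))\<^sup>2)"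
    "expectation (\<lambda>\<omega>. (cmod (G \<omega>))\<^sup>2) = (cmod (c k0))\<^sup>2 / s * n + (1 - (cmod (c k0))\<^sup>2 / s)"
proof -
  define B where "B = (\<Sum>k\<in>UNIV - {k0}. (cmod (c k))\<^sup>2)"
  have s_B: "s = (cmod (c k0))\<^sup>2 + B"
    unfolding s_def B_def by (rule sum.remove) auto
  have B: "0 < B" using pos by (simp add: B_def)
  then have s: "0 < s" by (simp add: s_B add_nonneg_pos)
  define \<gamma> where "\<gamma> = cnj (c k0) * of_real (1 / s)"
  define E where "E = (\<lambda>m \<omega>. Y (k0, m) \<omega> - \<gamma> * S m \<omega>)"
  have split: "indep_var borel (S m) borel (E m) \<and> distr M borel (S m) = complex_normal s \<and>
      distr M borel (E m) = complex_normal (B / s)" if m: "m < n" for m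
  proof -
    have ind_m: "indep_vars (\<lambda>_. borel) (\<lambda>k. Y (k, m)) UNIV"
      using indep_vars_reindex[OF indep_vars_subset[OF ind], of "\<lambda>k. (k, m)" UNIV] m
      by (auto simp: inj_on_def)
    then have "indep_vars (\<lambda>_. borel) (\<lambda>k. Y (k, m)) (insert k0 (UNIV - {k0}))"
      by (simp add: insert_UNIV)
    \<comment> \<open>Within one antenna the term \<open>k0\<close> is independent of the rest, so
      the regression applies with A = 1 and noise variance B.\<close>
    then have i: "indep_var borel (Y (k0, m)) borel (\<lambda>\<omega>. \<Sum>k\<in>UNIV - {k0}. c k * Y (k, m) \<omega>)"
      by (intro indep_var_linear_combination) auto
    have d: "distr M borel (\<lambda>\<omega>. \<Sum>k\<in>UNIV - {k0}. c k * Y (k, m) \<omega>) = complex_normal B"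
      unfolding B_def using pos Y[OF m] by (intro complex_normal_linear_combination indep_vars_subset[OF ind_m]) auto
    have S_eq: "S m = (\<lambda>\<omega>. c k0 * Y (k0, m) \<omega> + (\<Sum>k\<in>UNIV - {k0}. c k * Y (k, m) \<omega>))"
      unfolding S_def by (intro ext sum.remove) auto
    show ?thesis
      using complex_normal_regression_indep[OF i Y[OF m] d zero_less_one B, of "c k0"]
      unfolding E_def \<gamma>_def S_eq mult_1_right mult_1_left s_B[symmetric] by blast
  qed
  \<comment> \<open>Different antennas use disjoint blocks of \<open>Y\<close>, so the pairs
    \<open>(S m, E m)\<close> are independent across m; with \<open>split\<close> this gives the
    flat family.\<close>
  have "indep_vars (\<lambda>m. PiM (UNIV \<times> {m}) (\<lambda>_. borel)) (\<lambda>m \<omega>. restrict (\<lambda>i. Y i \<omega>) (UNIV \<times> {m})) {..<n}"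
    by (rule indep_vars_restrict[OF ind]) (auto simp: disjoint_family_on_def)
  then have "indep_vars (\<lambda>_. borel \<Otimes>\<^sub>M borel) (\<lambda>m \<omega>. (\<lambda>f. (\<Sum>k\<in>UNIV. c k * f (k, m), f (k0, m) - \<gamma> * (\<Sum>k\<in>UNIV. c k * f (k, m))))
      (restrict (\<lambda>i. Y i \<omega>) (UNIV \<times> {m}))) {..<n}"
  proof (rule indep_vars_compose2)
    fix m
    have [measurable]: "(\<lambda>f. f (k, m)) \<in> measurable (PiM (UNIV \<times> {m}) (\<lambda>_. borel)) borel" for k
      by (intro measurable_component_singleton) auto
    show "(\<lambda>f. (\<Sum>k\<in>UNIV. c k * f (k, m), f (k0, m) - \<gamma> * (\<Sum>k\<in>UNIV. c k * f (k, m))))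
      \<in> measurable (PiM (UNIV \<times> {m}) (\<lambda>_. borel)) (borel \<Otimes>\<^sub>M borel)" by measurable
  qed
  then have joint: "indep_vars (\<lambda>_. borel \<Otimes>\<^sub>M borel) (\<lambda>m \<omega>. (S m \<omega>, E m \<omega>)) {..<n}"
    by (simp add: S_def E_def)
  have indSE: "indep_vars (\<lambda>_. borel) (\<lambda>(m, b). if b then S m else E m) ({..<n} \<times> UNIV)"
    using n split by (intro indep_vars_pair joint) (auto simp: lessThan_empty_iff)
  have G_eq: "G = (\<lambda>\<omega>. \<Sum>m<n. (\<gamma> * S m \<omega> + E m \<omega>) * (cnj (S m \<omega>) / of_real (sqrt (\<Sum>m<n. (cmod (S m \<omega>))\<^sup>2))))"
    by (simp add: G_def E_def)
  have v: "0 < B / s" using B s by simp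
  have mom: "integrable M G" "expectation G = \<gamma> * of_real (sqrt s * (Gamma (real n + 1/2) / Gamma (real n)))"
    "integrable M (\<lambda>\<omega>. (cmod (G \<omega>))\<^sup>2)" "expectation (\<lambda>\<omega>. (cmod (G \<omega>))\<^sup>2) = (cmod \<gamma>)\<^sup>2 * (n * s) + B / s"
    unfolding G_eq by (rule beamforming_moments[OF n s v indSE]; use split in blast)+
  show "integrable M G" "integrable M (\<lambda>\<omega>. (cmod (G \<omega>))\<^sup>2)"
    by (fact mom)+
  have "expectation G = \<gamma> * of_real (sqrt s * (Gamma (real n + 1/2) / Gamma (real n)))"
    by (fact mom)
  also have "\<dots> = cnj (c k0) * of_real ((1 / s) * (sqrt s * (Gamma (real n + 1/2) / Gamma (real n))))"
    by (simp only: \<gamma>_def of_real_mult mult.assoc)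
  also have "(1 / s) * (sqrt s * (Gamma (real n + 1/2) / Gamma (real n))) = Gamma (real n + 1/2) / Gamma (real n) / sqrt s"
  proof -
    have "1 / s * (sqrt s * x) = sqrt s / s * x" for x by simp
    then show ?thesis
      by (simp only: sqrt_divide_self_eq[OF less_imp_le[OF s]]) (simp only: divide_inverse mult_ac)
  qed
  finally show "expectation G = cnj (c k0) * of_real (Gamma (real n + 1/2) / Gamma (real n) / sqrt s)" .
  have "expectation (\<lambda>\<omega>. (cmod (G \<omega>))\<^sup>2) = (cmod \<gamma>)\<^sup>2 * (n * s) + B / s"
    by (fact mom)
  also have "\<dots> = (cmod (c k0))\<^sup>2 / s * n + (1 - (cmod (c k0))\<^sup>2 / s)"
  proof -
    have "(cmod \<gamma>)\<^sup>2 * s = (cmod (c k0))\<^sup>2 / s"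
      using s by (simp add: \<gamma>_def norm_mult norm_divide power_divide power2_eq_square)
    moreover have "B / s = 1 - (cmod (c k0))\<^sup>2 / s"
      using s by (simp add: diff_divide_eq_iff) (simp add: s_B)
    moreover have "(cmod \<gamma>)\<^sup>2 * (n * s) = (cmod \<gamma>)\<^sup>2 * s * n"
      by (simp only: mult_ac)
    ultimately show ?thesis by (simp only:)
  qed
  finally show "expectation (\<lambda>\<omega>. (cmod (G \<omega>))\<^sup>2) = (cmod (c k0))\<^sup>2 / s * n + (1 - (cmod (c k0))\<^sup>2 / s)" .
qed

lemma (in prob_space) complex_variance_eq:
  assumes "integrable M X" "integrable M (\<lambda>\<omega>. (cmod (X \<omega>))\<^sup>2)"
  shows "complex_variance M X = expectation (\<lambda>\<omega>. (cmod (X \<omega>))\<^sup>2) - (cmod (expectation X))\<^sup>2"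
proof -
  define \<mu> where "\<mu> = expectation X"
  have "(cmod (z - \<mu>))\<^sup>2 = (cmod z)\<^sup>2 - 2 * Re (cnj \<mu> * z) + (cmod \<mu>)\<^sup>2" for z
    unfolding cmod_power2 by (simp add: power2_eq_square algebra_simps)
  then have "complex_variance M X = expectation (\<lambda>\<omega>. (cmod (X \<omega>))\<^sup>2 - 2 * Re (cnj \<mu> * X \<omega>) + (cmod \<mu>)\<^sup>2)"
    by (simp add: complex_variance_def \<mu>_def)
  also have "\<dots> = expectation (\<lambda>\<omega>. (cmod (X \<omega>))\<^sup>2) - 2 * Re (cnj \<mu> * \<mu>) + (cmod \<mu>)\<^sup>2"
    using assms integrable_Re[OF integrable_mult_right[OF assms(1), of "cnj \<mu>"]]
      integral_Re[OF integrable_mult_right[OF assms(1), of "cnj \<mu>"]]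
    by (simp add: prob_space \<mu>_def del: times_complex.sel)
  also have "\<dots> = expectation (\<lambda>\<omega>. (cmod (X \<omega>))\<^sup>2) - (cmod \<mu>)\<^sup>2"
    unfolding cmod_power2 by (simp add: power2_eq_square)
  finally show ?thesis by (simp add: \<mu>_def)
qed

section \<open>The multi-cell system\<close>

lemma kappa_pos:
  assumes "0 < p_r" and "\<And>j l. 0 \<le> \<beta> j l"
  shows "0 < kappa p_r \<tau> \<beta> l"
  using assms by (auto simp: kappa_def intro!: add_pos_nonneg mult_nonneg_nonneg sum_nonneg)

text \<open>Identifies the fraction in the last sum of the rate formula as the residual variance of
  a channel entry after regression on the estimate.\<close>

lemma residual_fraction:
  fixes p_r :: real and \<tau> :: nat
  assumes "0 < p_r" and "\<And>j l. 0 \<le> \<beta> j l"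
  shows "(1 + p_r * \<tau> * (\<Sum>i\<in>UNIV - {j}. \<beta> i l)) / kappa p_r \<tau> \<beta> l
    = 1 - p_r * \<tau> * \<beta> j l / kappa p_r \<tau> \<beta> l"
proof -
  have "kappa p_r \<tau> \<beta> l = p_r * \<tau> * \<beta> j l + (1 + p_r * \<tau> * (\<Sum>i\<in>UNIV - {j}. \<beta> i l))"
    unfolding kappa_def by (subst sum.remove[of _ j]) (auto simp: algebra_simps)
  then show ?thesis
    using kappa_pos[where \<beta>=\<beta>, OF assms, of \<tau> l] by (simp add: divide_eq_eq left_diff_distrib)
qed

text \<open>Users and noise coordinates are merged into the index type \<open>'l + 't\<close>; all
  terms are then i.i.d. unit normals and the abstract lemma applies with
  \<open>k0 = Inl j\<close>.\<close>

lemma gain_moments: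
  fixes p_f p_r :: real and \<psi> :: "complex ^ 't::finite" and \<beta> :: "'l::finite \<Rightarrow> 'l \<Rightarrow> real" and j l :: 'l
  assumes model: "channel_model P n h W" and n: "1 \<le> n"
    and pf: "0 < p_f" and pr: "0 < p_r"
    and \<beta>: "\<And>j l. 0 \<le> \<beta> j l" and \<beta>_pos: "0 < \<beta> l l"
    and unit: "(\<Sum>t\<in>UNIV. hermitian \<psi> $ t * \<psi> $ t) = 1"
  defines "g \<equiv> gain p_f p_r \<beta> \<psi> n h W l j"
  defines "x \<equiv> p_r * CARD('t) * \<beta> j l / kappa p_r CARD('t) \<beta> l"
  shows "integrable P g" "(cmod (\<integral>\<omega>. g \<omega> \<partial>P))\<^sup>2 = p_f * \<beta> j l * x * (Gamma (real n + 1/2) / Gamma (real n))\<^sup>2"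
    "integrable P (\<lambda>\<omega>. (cmod (g \<omega>))\<^sup>2)" "(\<integral>\<omega>. (cmod (g \<omega>))\<^sup>2 \<partial>P) = p_f * \<beta> j l * (x * n + (1 - x))"
proof -
  define X where "X = case_sum (\<lambda>(j, l, m). h j l m) (\<lambda>(l, m, t) \<omega>. W l m \<omega> $ t)"
  define I where "I = ((UNIV :: 'l set) \<times> (UNIV :: 'l set) \<times> {..<n}) <+> ((UNIV :: 'l set) \<times> {..<n} \<times> (UNIV :: 't set))"
  have iid: "iid_complex_normal P I X"
    using model by (simp add: channel_model_def X_def I_def)
  then interpret prob_space P by (simp add: iid_complex_normal_def)
  \<comment> \<open>Embeds the entries seen by base station \<open>l\<close> into the index set of
    the global i.i.d. family.\<close>
  define f :: "('l + 't) \<times> nat \<Rightarrow> 'l \<times> 'l \<times> nat + 'l \<times> nat \<times> 't"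
    where "f = (\<lambda>(k, m). case k of Inl i \<Rightarrow> Inl (i, l, m) | Inr t \<Rightarrow> Inr (l, m, t))"
  define Y where "Y = (\<lambda>km. X (f km))"
  have Y_simps: "Y (Inl i, m) = h i l m" "Y (Inr t, m) = (\<lambda>\<omega>. W l m \<omega> $ t)" for i t m
    by (simp_all add: Y_def X_def f_def)
  have f_I: "f ` (UNIV \<times> {..<n}) \<subseteq> I" by (auto simp: f_def I_def split: sum.splits)
  have inj_f: "inj_on f (UNIV \<times> {..<n})" by (auto simp: inj_on_def f_def split: sum.splits)
  have "indep_vars (\<lambda>_. borel) X I"
    using iid by (simp add: iid_complex_normal_def)
  from indep_vars_reindex[OF indep_vars_subset[OF this f_I] inj_f]
  have indY: "indep_vars (\<lambda>_. borel) Y (UNIV \<times> {..<n})"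
    by (simp add: Y_def)
  have distY: "distr P borel (Y (k, m)) = complex_normal 1" if "m < n" for k m
  proof -
    have "f (k, m) \<in> I" using f_I that by auto
    then have "std_complex_normal P (Y (k, m))"
      using iid by (simp add: iid_complex_normal_def Y_def)
    then show ?thesis by (rule std_complex_normal_imp_distr)
  qed
  define c where "c = case_sum (\<lambda>i. complex_of_real (sqrt (p_r * CARD('t) * \<beta> i l))) (\<lambda>t. cnj (\<psi> $ t))"
  have sum_Inl_Inr: "(\<Sum>k\<in>UNIV. F k) = (\<Sum>i\<in>UNIV. F (Inl i)) + (\<Sum>t\<in>UNIV. F (Inr t))"
    for F :: "'l + 't \<Rightarrow> 'b::comm_monoid_add"
    using sum.Plus[of "UNIV :: 'l set" "UNIV :: 't set" F] by (simp add: UNIV_Plus_UNIV)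
  have unit': "(\<Sum>t\<in>UNIV. (cmod (\<psi> $ t))\<^sup>2) = 1"
  proof -
    have "complex_of_real (\<Sum>t\<in>UNIV. (cmod (\<psi> $ t))\<^sup>2) = (\<Sum>t\<in>UNIV. hermitian \<psi> $ t * \<psi> $ t)"
      unfolding of_real_sum complex_norm_square by (simp add: hermitian_def mult.commute)
    then show ?thesis unfolding unit by (simp only: of_real_eq_1_iff)
  qed
  have c_Inl: "(cmod (c (Inl i)))\<^sup>2 = p_r * CARD('t) * \<beta> i l" for i
    using pr \<beta> by (simp add: c_def)
  have k: "(\<Sum>k\<in>UNIV. (cmod (c k))\<^sup>2) = kappa p_r CARD('t) \<beta> l"
    by (simp add: sum_Inl_Inr c_Inl kappa_def sum_distrib_left) (simp add: c_def unit')
  have k_pos: "0 < kappa p_r CARD('t) \<beta> l" by (rule kappa_pos[where \<beta>=\<beta>, OF pr \<beta>])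
  have "(\<Sum>k\<in>UNIV - {Inl j}. (cmod (c k))\<^sup>2) = kappa p_r CARD('t) \<beta> l - p_r * CARD('t) * \<beta> j l"
    using sum.remove[of UNIV "Inl j" "\<lambda>k. (cmod (c k))\<^sup>2"] by (simp add: k c_Inl)
  also have "\<dots> = 1 + p_r * CARD('t) * (\<Sum>i\<in>UNIV - {j}. \<beta> i l)"
    unfolding kappa_def by (subst sum.remove[of UNIV j]) (auto simp: algebra_simps)
  \<comment> \<open>The 1 is the total noise weight of the unit vector \<psi>; it keeps the rest
    positive even if no other user is received.\<close>
  also have "\<dots> > 0"
    using pr \<beta> by (intro add_pos_nonneg mult_nonneg_nonneg sum_nonneg) auto
  finally have pos: "0 < (\<Sum>k\<in>UNIV - {Inl j}. (cmod (c k))\<^sup>2)" .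
  define S where "S = (\<lambda>m \<omega>. \<Sum>k\<in>UNIV. c k * Y (k, m) \<omega>)"
  define G where "G = (\<lambda>\<omega>. \<Sum>m<n. Y (Inl j, m) \<omega> * (cnj (S m \<omega>) / of_real (sqrt (\<Sum>m<n. (cmod (S m \<omega>))\<^sup>2))))"
  have "integrable P G" "expectation G = cnj (c (Inl j)) * of_real (Gamma (real n + 1/2) / Gamma (real n) / sqrt (\<Sum>k\<in>UNIV. (cmod (c k))\<^sup>2))"
    "integrable P (\<lambda>\<omega>. (cmod (G \<omega>))\<^sup>2)"
    "expectation (\<lambda>\<omega>. (cmod (G \<omega>))\<^sup>2) = (cmod (c (Inl j)))\<^sup>2 / (\<Sum>k\<in>UNIV. (cmod (c k))\<^sup>2) * n
      + (1 - (cmod (c (Inl j)))\<^sup>2 / (\<Sum>k\<in>UNIV. (cmod (c k))\<^sup>2))"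
    unfolding G_def S_def by (rule combined_beamforming_moments[OF n indY distY pos]; assumption)+
  note G = this[unfolded k c_Inl, folded x_def]
  \<comment> \<open>The positive factor of the estimate, which cancels in the precoder; positivity
    comes from \<beta> l l > 0.\<close>
  define y where "y = sqrt (p_r * CARD('t) * \<beta> l l) / kappa p_r CARD('t) \<beta> l"
  have y: "0 < y" using pr \<beta>_pos k_pos by (simp add: y_def)
  have mmse: "mmse_estimate p_r \<beta> \<psi> h W l l m \<omega> = of_real y * S m \<omega>" for m \<omega>
    by (simp add: mmse_estimate_eq[where \<beta>=\<beta>, OF unit pr \<beta>] y_def S_def sum_Inl_Inr Y_simps c_def)
  have prec: "precoder p_r \<beta> \<psi> n h W l m \<omega> = cnj (S m \<omega>) / of_real (sqrt (\<Sum>m<n. (cmod (S m \<omega>))\<^sup>2))" for m \<omega>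
  proof -
    have "L2_set (\<lambda>m. cmod (mmse_estimate p_r \<beta> \<psi> h W l l m \<omega>)) {..<n} = y * sqrt (\<Sum>m<n. (cmod (S m \<omega>))\<^sup>2)"
      using y by (simp add: L2_set_def mmse norm_mult power_mult_distrib sum_distrib_left[symmetric] real_sqrt_mult)
    then show ?thesis using y by (simp add: precoder_def mmse)
  qed
  have g: "g \<omega> = of_real (sqrt (p_f * \<beta> j l)) * G \<omega>" for \<omega>
    by (simp add: g_def gain_def prec G_def Y_simps)
  have g2: "(cmod (g \<omega>))\<^sup>2 = p_f * \<beta> j l * (cmod (G \<omega>))\<^sup>2" for \<omega>
    using pf \<beta>[of j l] by (simp add: g norm_mult power_mult_distrib)
  show "integrable P g" unfolding g[abs_def] using G(1) by simp
  show "integrable P (\<lambda>\<omega>. (cmod (g \<omega>))\<^sup>2)" unfolding g2 using G(3) by simp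
  show "(\<integral>\<omega>. (cmod (g \<omega>))\<^sup>2 \<partial>P) = p_f * \<beta> j l * (x * n + (1 - x))"
    unfolding g2 using G(4) by simp
  have "(cmod (\<integral>\<omega>. g \<omega> \<partial>P))\<^sup>2 = p_f * \<beta> j l * (cmod (expectation G))\<^sup>2"
    unfolding g using pf \<beta>[of j l] by (simp add: norm_mult power_mult_distrib)
  also have "(cmod (expectation G))\<^sup>2 = x * (Gamma (real n + 1/2) / Gamma (real n))\<^sup>2"
    using k_pos by (simp only: G(2) norm_mult power_mult_distrib complex_mod_cnj c_Inl norm_of_real power2_abs power_divide real_sqrt_pow2[OF less_imp_le] x_def)
       (simp add: mult_ac)
  finally show "(cmod (\<integral>\<omega>. g \<omega> \<partial>P))\<^sup>2 = p_f * \<beta> j l * x * (Gamma (real n + 1/2) / Gamma (real n))\<^sup>2"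
    by (simp only: mult.assoc)
qed

text \<open>The variance of the own gain leaves a residual 1 - x j of the same shape as those of the
  interferers; moving it over extends the last sum to all cells.\<close>

lemma rate_eq:
  fixes p_f p_r :: real and \<psi> :: "complex ^ 't::finite" and \<beta> :: "'l::finite \<Rightarrow> 'l \<Rightarrow> real" and j :: 'l
  assumes model: "channel_model P n h W" and n: "1 \<le> n"
    and pf: "0 < p_f" and pr: "0 < p_r"
    and \<beta>: "\<And>j l. 0 \<le> \<beta> j l" and \<beta>_pos: "\<And>l. 0 < \<beta> l l"
    and unit: "(\<Sum>t\<in>UNIV. hermitian \<psi> $ t * \<psi> $ t) = 1"
  defines "\<rho> \<equiv> Gamma (real n + 1/2) / Gamma (real n)"
  defines "x \<equiv> \<lambda>l. p_r * CARD('t) * \<beta> j l / kappa p_r CARD('t) \<beta> l"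
  shows "rate p_f p_r \<beta> \<psi> P n h W j =
    cap ((p_f * \<beta> j j * x j * \<rho>\<^sup>2) /
      (1 + p_f * \<beta> j j * x j * (n - \<rho>\<^sup>2) + (\<Sum>l\<in>UNIV - {j}. p_f * \<beta> j l * x l * n)
         + (\<Sum>l\<in>UNIV. p_f * \<beta> j l * (1 - x l))))"
proof -
  interpret prob_space P
    using model by (simp add: channel_model_def iid_complex_normal_def)
  let ?g = "\<lambda>l. gain p_f p_r \<beta> \<psi> n h W l j"
  have g: "integrable P (?g l)" "(cmod (\<integral>\<omega>. ?g l \<omega> \<partial>P))\<^sup>2 = p_f * \<beta> j l * x l * \<rho>\<^sup>2"
    "integrable P (\<lambda>\<omega>. (cmod (?g l \<omega>))\<^sup>2)" "(\<integral>\<omega>. (cmod (?g l \<omega>))\<^sup>2 \<partial>P) = p_f * \<beta> j l * (x l * n + (1 - x l))" for l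
    unfolding x_def \<rho>_def by (rule gain_moments[where \<beta>=\<beta>, OF model n pf pr \<beta> \<beta>_pos unit])+
  have "1 + complex_variance P (?g j) + (\<Sum>l\<in>UNIV - {j}. \<integral>\<omega>. (cmod (?g l \<omega>))\<^sup>2 \<partial>P)
    = 1 + (p_f * \<beta> j j * (x j * n + (1 - x j)) - p_f * \<beta> j j * x j * \<rho>\<^sup>2)
      + (\<Sum>l\<in>UNIV - {j}. p_f * \<beta> j l * (x l * n + (1 - x l)))"
    by (simp only: complex_variance_eq[OF g(1,3)] g(2,4))
  also have "\<dots> = 1 + p_f * \<beta> j j * x j * (n - \<rho>\<^sup>2) + (\<Sum>l\<in>UNIV - {j}. p_f * \<beta> j l * x l * n)
         + (p_f * \<beta> j j * (1 - x j) + (\<Sum>l\<in>UNIV - {j}. p_f * \<beta> j l * (1 - x l)))"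
    by (simp add: sum.distrib distrib_left right_diff_distrib mult.assoc)
  also have "p_f * \<beta> j j * (1 - x j) + (\<Sum>l\<in>UNIV - {j}. p_f * \<beta> j l * (1 - x l)) = (\<Sum>l\<in>UNIV. p_f * \<beta> j l * (1 - x l))"
    by (rule sum.remove[symmetric]) auto
  finally show ?thesis
    by (simp only: rate_def Let_def g(2))
qed

section \<open>Asymptotics of the Gamma ratio and of the rate\<close>

text \<open>Convexity of ln Gamma at the midpoint of x and x + 1.\<close>

lemma Gamma_midpoint:
  assumes "0 < (x :: real)"
  shows "(Gamma (x + 1/2))\<^sup>2 \<le> Gamma x * Gamma (x + 1)"
proof -
  have pos: "0 < Gamma x" "0 < Gamma (x + 1)" "0 < Gamma (x + 1/2)"
    using assms by (simp_all add: Gamma_real_pos)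
  have "ln (Gamma ((1 - 1/2) * x + 1/2 * (x + 1))) \<le> (1 - 1/2) * ln (Gamma x) + 1/2 * ln (Gamma (x + 1))"
    using convex_onD[OF log_convex_Gamma_real, of "1/2" x "x + 1"] assms by simp
  moreover have "(1 - 1/2) * x + 1/2 * (x + 1) = x + 1/2" by (simp add: field_simps)
  ultimately have "2 * ln (Gamma (x + 1/2)) \<le> ln (Gamma x) + ln (Gamma (x + 1))"
    by (simp add: field_simps)
  then have "ln ((Gamma (x + 1/2))\<^sup>2) \<le> ln (Gamma x * Gamma (x + 1))"
    using pos by (simp add: ln_mult ln_realpow)
  then show ?thesis using pos by (subst (asm) ln_le_cancel_iff) auto
qed

text \<open>The upper bound is the midpoint inequality at x, the lower one the same inequality at x
  - 1/2, each combined with the recursion Gamma (y + 1) = y Gamma y. The second use is why x exceeds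
  1/2.\<close>

lemma Gamma_ratio_bounds:
  assumes x: "1/2 < (x :: real)"
  shows "(Gamma (x + 1/2) / Gamma x)\<^sup>2 \<le> x" "x - 1/2 \<le> (Gamma (x + 1/2) / Gamma x)\<^sup>2"
proof -
  have pos: "0 < Gamma x" "0 < Gamma (x + 1/2)"
    using x by (simp_all add: Gamma_real_pos)
  have "(Gamma (x + 1/2))\<^sup>2 \<le> Gamma x * (x * Gamma x)"
    using Gamma_midpoint[of x] Gamma_plus1[of x] x by (simp add: nonpos_Ints_def)
  then show "(Gamma (x + 1/2) / Gamma x)\<^sup>2 \<le> x"
    using pos by (simp add: power_divide divide_le_eq power2_eq_square mult_ac)
  have "(x - 1/2) * (Gamma x)\<^sup>2 \<le> (x - 1/2) * (Gamma (x - 1/2) * Gamma (x + 1/2))"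
    using Gamma_midpoint[of "x - 1/2"] x by (intro mult_left_mono) (auto simp: add.commute)
  also have "\<dots> = (Gamma (x + 1/2))\<^sup>2"
    using Gamma_plus1[of "x - 1/2"] x by (simp add: power2_eq_square nonpos_Ints_def add.commute)
  finally show "x - 1/2 \<le> (Gamma (x + 1/2) / Gamma x)\<^sup>2"
    using pos by (simp add: power_divide le_divide_eq)
qed

lemma Gamma_ratio_square_asymp:
  "(\<lambda>n. (Gamma (real n + 1/2) / Gamma (real n))\<^sup>2 / n) \<longlonglongrightarrow> 1"
proof (rule tendsto_sandwich)
  show "\<forall>\<^sub>F n in sequentially. 1 - 1/2 / real n \<le> (Gamma (real n + 1/2) / Gamma (real n))\<^sup>2 / n"
    using eventually_gt_at_top[of 0]
  proof eventually_elim
    case (elim n)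
    then show ?case
      using divide_right_mono[OF Gamma_ratio_bounds(2)[of "real n"], of "real n"] by (simp add: diff_divide_distrib)
  qed
  show "\<forall>\<^sub>F n in sequentially. (Gamma (real n + 1/2) / Gamma (real n))\<^sup>2 / n \<le> 1"
    using eventually_gt_at_top[of 0]
  proof eventually_elim
    case (elim n)
    then show ?case
      using divide_right_mono[OF Gamma_ratio_bounds(1)[of "real n"], of "real n"] by simp
  qed
  show "(\<lambda>n. 1 - 1/2 / real n) \<longlonglongrightarrow> 1"
    using tendsto_diff[OF tendsto_const[of 1] lim_const_over_n[of "1/2"]] by simp
qed simp

text \<open>Dividing numerator and denominator by n makes them converge to a and b. For b = 0 the
  bound \<open>r_le\<close> keeps the denominator positive, so it tends to 0 from above and the
  logarithm diverges to infinity.\<close>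

lemma cap_ratio_limit:
  fixes a b d :: real and r :: "nat \<Rightarrow> real"
  assumes r: "(\<lambda>n. r n / n) \<longlonglongrightarrow> 1" and a: "0 < a" and b: "0 \<le> b" and d: "0 \<le> d"
    and r_le: "\<And>n. 1 \<le> n \<Longrightarrow> r n \<le> n"
  shows "(\<lambda>n. ereal (cap (a * r n / (1 + a * (n - r n) + b * n + d)))) \<longlonglongrightarrow> (if b = 0 then \<infinity> else ereal (cap (a / b)))"
proof -
  let ?N = "\<lambda>n. a * (r n / n)" and ?D = "\<lambda>n. (1 + d) / real n + a * (1 - r n / n) + b"
  have N: "?N \<longlonglongrightarrow> a" using tendsto_mult[OF tendsto_const[of a] r] by simp
  have D: "?D \<longlonglongrightarrow> b"
    using tendsto_add[OF tendsto_add[OF lim_const_over_n[of "1 + d"]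
        tendsto_mult[OF tendsto_const[of a] tendsto_diff[OF tendsto_const[of 1] r]]] tendsto_const[of b]]
    by simp
  have D_pos: "0 < ?D n" if "1 \<le> n" for n
    using that a b d r_le[OF that] by (intro add_pos_nonneg mult_nonneg_nonneg) auto
  have eq: "\<forall>\<^sub>F n in sequentially. ?N n / ?D n = a * r n / (1 + a * (n - r n) + b * n + d)"
    using eventually_ge_at_top[of 1]
  proof eventually_elim
    case (elim n)
    then have "?D n * n = 1 + a * (n - r n) + b * n + d" "?N n * n = a * r n"
      by (simp_all add: field_simps)
    then show ?case using elim by (metis mult_divide_mult_cancel_right of_nat_0_less_iff order_less_le_trans zero_less_one less_numeral_extra(3))
  qed
  show ?thesis
  proof (cases "b = 0")
    case False
    then have "0 < b" using b by simp
    then have "(\<lambda>n. cap (?N n / ?D n)) \<longlonglongrightarrow> cap (a / b)"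
      unfolding cap_def using a
      by (intro tendsto_log tendsto_add tendsto_divide N D tendsto_const) (auto simp: add_pos_nonneg add_nonneg_eq_0_iff)
    then have "(\<lambda>n. cap (a * r n / (1 + a * (n - r n) + b * n + d))) \<longlonglongrightarrow> cap (a / b)"
      by (rule Lim_transform_eventually) (use eq in eventually_elim, simp only:)
    then show ?thesis using False by simp
  next
    case True
    have "\<forall>\<^sub>F n in sequentially. ?D n \<in> {0<..} \<and> ?D n \<noteq> 0"
      by (rule eventually_sequentiallyI[of 1]) (metis D_pos greaterThan_iff less_irrefl)
    then have "filterlim ?D (at_right 0) sequentially"
      using D unfolding filterlim_at True by blast
    then have inv: "filterlim (\<lambda>n. inverse (?D n)) at_top sequentially"
      by (rule filterlim_compose[OF filterlim_inverse_at_top_right])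
    have "filterlim (\<lambda>n. ?N n * inverse (?D n)) at_top sequentially"
      by (rule filterlim_tendsto_pos_mult_at_top[OF N a inv])
    then have "filterlim (\<lambda>n. 1 + ?N n * inverse (?D n)) at_top sequentially"
      by (rule filterlim_tendsto_add_at_top[OF tendsto_const])
    then have "filterlim (\<lambda>n. ln (1 + ?N n * inverse (?D n))) at_top sequentially"
      by (rule filterlim_compose[OF ln_at_top])
    then have "filterlim (\<lambda>n. inverse (ln 2) * ln (1 + ?N n * inverse (?D n))) at_top sequentially"
      by (rule filterlim_tendsto_pos_mult_at_top[OF tendsto_const, rotated]) simp
    moreover have "cap (?N n / ?D n) = inverse (ln 2) * ln (1 + ?N n * inverse (?D n))" for n
      by (simp only: cap_def log_def divide_inverse mult.commute)
    ultimately have "filterlim (\<lambda>n. cap (?N n / ?D n)) at_top sequentially"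
      by (simp only:)
    then have "filterlim (\<lambda>n. cap (a * r n / (1 + a * (n - r n) + b * n + d))) at_top sequentially"
      by (rule filterlim_cong[OF refl refl, THEN iffD1, rotated])
         (use eq in eventually_elim, simp only:)
    then show ?thesis using True
      by (simp add: tendsto_PInfty filterlim_at_top_dense)
  qed
qed

lemma theta_moments:
  assumes "iid_complex_normal Q {..<n} u" and n: "1 \<le> n"
  defines "\<rho> \<equiv> Gamma (real n + 1/2) / Gamma (real n)"
  shows "prob_space.expectation Q (theta n u) = \<rho>"
    "prob_space.expectation Q (\<lambda>\<omega>. (theta n u \<omega>)\<^sup>2) = n"
    "prob_space.variance Q (theta n u) = n - \<rho>\<^sup>2"
proof -
  interpret prob_space Q using assms by (simp add: iid_complex_normal_def)
  have ind: "indep_vars (\<lambda>_. borel) u {..<n}"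
    and d: "\<And>m. m < n \<Longrightarrow> distr Q borel (u m) = complex_normal 1"
    using assms std_complex_normal_imp_distr(2) by (auto simp: iid_complex_normal_def)
  have theta: "theta n u = (\<lambda>\<omega>. sqrt (\<Sum>m<n. (cmod (u m \<omega>))\<^sup>2))"
    by (simp add: theta_def fun_eq_iff)
  have mom: "integrable Q (theta n u)" "expectation (theta n u) = sqrt 1 * \<rho>"
    "integrable Q (\<lambda>\<omega>. (theta n u \<omega>)\<^sup>2)" "expectation (\<lambda>\<omega>. (theta n u \<omega>)\<^sup>2) = n * 1"
    using complex_normal_norm_moments[OF ind d zero_less_one n]
    by (simp_all add: theta \<rho>_def del: real_sqrt_pow2_iff real_sqrt_pow2)
  then show "expectation (theta n u) = \<rho>" "expectation (\<lambda>\<omega>. (theta n u \<omega>)\<^sup>2) = n"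
    by simp_all
  then show "variance (theta n u) = n - \<rho>\<^sup>2"
    using variance_eq[OF mom(1,3)] by simp
qed

text \<open>The number of antennas indexes the models: each M has its own spaces \<open>P M\<close>
  and \<open>Q M\<close>, as the rate depends only on the law. The last claim lives in the extended
  reals so that the vanishing interference sum can give infinity.\<close>

theorem theorem3:
  fixes p_f p_r :: real
    and \<tau> :: nat
    and \<beta> :: "'l::finite \<Rightarrow> 'l \<Rightarrow> real"
    and \<psi> :: "complex ^ 't::finite"
    and P :: "nat \<Rightarrow> 'a measure"
    and h :: "nat \<Rightarrow> 'l \<Rightarrow> 'l \<Rightarrow> nat \<Rightarrow> 'a \<Rightarrow> complex"
    and W :: "nat \<Rightarrow> 'l \<Rightarrow> nat \<Rightarrow> 'a \<Rightarrow> complex ^ 't"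
    and Q :: "nat \<Rightarrow> 'b measure"
    and u :: "nat \<Rightarrow> nat \<Rightarrow> 'b \<Rightarrow> complex"
  assumes "p_f > 0" and "p_r > 0"
    and "\<tau> = CARD('t)"
    and "\<And>j l. \<beta> j l \<ge> 0" and "\<And>l. \<beta> l l > 0"
    and "(\<Sum>t\<in>UNIV. hermitian \<psi> $ t * \<psi> $ t) = 1"
  shows
    "(\<forall>M\<ge>1. iid_complex_normal (Q M) {..<M} (u M) \<longrightarrow>
        prob_space.expectation (Q M) (theta M (u M)) = Gamma (real M + 1/2) / Gamma (real M) \<and>
        prob_space.expectation (Q M) (\<lambda>\<omega>. (theta M (u M) \<omega>)\<^sup>2) = real M \<and>
        prob_space.variance (Q M) (theta M (u M)) =
          real M - (prob_space.expectation (Q M) (theta M (u M)))\<^sup>2) \<and>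
     (\<forall>M\<ge>1. channel_model (P M) M (h M) (W M) \<and> iid_complex_normal (Q M) {..<M} (u M) \<longrightarrow>
        (\<forall>j. rate p_f p_r \<beta> \<psi> (P M) M (h M) (W M) j =
          cap ((p_f * \<beta> j j * (p_r * \<tau> * \<beta> j j / kappa p_r \<tau> \<beta> j) *
                  (prob_space.expectation (Q M) (theta M (u M)))\<^sup>2) /
               (1 + p_f * \<beta> j j * (p_r * \<tau> * \<beta> j j / kappa p_r \<tau> \<beta> j) *
                      prob_space.variance (Q M) (theta M (u M))
                  + (\<Sum>l\<in>UNIV - {j}. p_f * \<beta> j l * (p_r * \<tau> * \<beta> j l / kappa p_r \<tau> \<beta> l) *
                      prob_space.expectation (Q M) (\<lambda>\<omega>. (theta M (u M) \<omega>)\<^sup>2))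
                  + (\<Sum>l\<in>UNIV. p_f * \<beta> j l *
                      ((1 + p_r * \<tau> * (\<Sum>i\<in>UNIV - {j}. \<beta> i l)) / kappa p_r \<tau> \<beta> l)))))) \<and>
     ((\<forall>M\<ge>1. channel_model (P M) M (h M) (W M)) \<longrightarrow>
        (\<forall>j. (\<lambda>M. ereal (rate p_f p_r \<beta> \<psi> (P M) M (h M) (W M) j)) \<longlonglongrightarrow>
          (if (\<Sum>l\<in>UNIV - {j}. (\<beta> j l)\<^sup>2) = 0 then \<infinity>
           else ereal (cap (((\<beta> j j)\<^sup>2 / (1 + p_r * \<tau> * (\<Sum>i\<in>UNIV. \<beta> i j))) /
                  (\<Sum>l\<in>UNIV - {j}. (\<beta> j l)\<^sup>2 / (1 + p_r * \<tau> * (\<Sum>i\<in>UNIV. \<beta> i l))))))))"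
proof (intro conjI allI impI)
  note pf = assms(1) and pr = assms(2) and \<tau> = assms(3) and \<beta> = assms(4) and \<beta>_pos = assms(5) and unit = assms(6)
  fix M :: nat assume M: "1 \<le> M"
  {
    assume iid: "iid_complex_normal (Q M) {..<M} (u M)"
    note theta = theta_moments[OF iid M]
    show "prob_space.expectation (Q M) (theta M (u M)) = Gamma (real M + 1/2) / Gamma (real M)"
      "prob_space.expectation (Q M) (\<lambda>\<omega>. (theta M (u M) \<omega>)\<^sup>2) = real M"
      "prob_space.variance (Q M) (theta M (u M)) = real M - (prob_space.expectation (Q M) (theta M (u M)))\<^sup>2"
      using theta by simp_all
  }
  fix j
  assume model: "channel_model (P M) M (h M) (W M) \<and> iid_complex_normal (Q M) {..<M} (u M)"
  note theta = theta_moments[OF conjunct2[OF model] M]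
  show "rate p_f p_r \<beta> \<psi> (P M) M (h M) (W M) j =
          cap ((p_f * \<beta> j j * (p_r * \<tau> * \<beta> j j / kappa p_r \<tau> \<beta> j) *
                  (prob_space.expectation (Q M) (theta M (u M)))\<^sup>2) /
               (1 + p_f * \<beta> j j * (p_r * \<tau> * \<beta> j j / kappa p_r \<tau> \<beta> j) *
                      prob_space.variance (Q M) (theta M (u M))
                  + (\<Sum>l\<in>UNIV - {j}. p_f * \<beta> j l * (p_r * \<tau> * \<beta> j l / kappa p_r \<tau> \<beta> l) *
                      prob_space.expectation (Q M) (\<lambda>\<omega>. (theta M (u M) \<omega>)\<^sup>2))
                  + (\<Sum>l\<in>UNIV. p_f * \<beta> j l *
                      ((1 + p_r * \<tau> * (\<Sum>i\<in>UNIV - {j}. \<beta> i l)) / kappa p_r \<tau> \<beta> l))))"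
    \<comment> \<open>The variance is rewritten first because it contains the expectation of
      \<open>theta\<close>; rewriting that one earlier would destroy the pattern.\<close>
    unfolding theta(3) unfolding theta(1,2) residual_fraction[where \<beta>=\<beta>, OF pr \<beta>] \<tau>
    by (rule rate_eq[where \<beta>=\<beta>, OF conjunct1[OF model] M pf pr \<beta> \<beta>_pos unit])
next
  note pf = assms(1) and pr = assms(2) and \<tau> = assms(3) and \<beta> = assms(4) and \<beta>_pos = assms(5) and unit = assms(6)
  assume model: "\<forall>M\<ge>1. channel_model (P M) M (h M) (W M)"
  fix j
  define k where "k = kappa p_r \<tau> \<beta>"
  have k: "0 < k l" for l unfolding k_def by (rule kappa_pos[where \<beta>=\<beta>, OF pr \<beta>])
  define a where "a = p_f * \<beta> j j * (p_r * \<tau> * \<beta> j j / k j)"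
  define b where "b = (\<Sum>l\<in>UNIV - {j}. p_f * \<beta> j l * (p_r * \<tau> * \<beta> j l / k l))"
  define d where "d = (\<Sum>l\<in>UNIV. p_f * \<beta> j l * ((1 + p_r * \<tau> * (\<Sum>i\<in>UNIV - {j}. \<beta> i l)) / k l))"
  have \<tau>_pos: "0 < real \<tau>" by (simp add: \<tau>)
  have a: "0 < a" using pf pr \<tau>_pos \<beta>_pos k by (simp add: a_def)
  have b: "0 \<le> b" using pf pr \<beta> k[THEN less_imp_le] by (auto simp: b_def intro!: sum_nonneg)
  have d: "0 \<le> d"
    using pf pr \<beta> k[THEN less_imp_le]
    by (auto simp: d_def intro!: sum_nonneg mult_nonneg_nonneg divide_nonneg_nonneg add_nonneg_nonneg)
  define r where "r = (\<lambda>n. (Gamma (real n + 1/2) / Gamma (real n))\<^sup>2)"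
  have rate: "rate p_f p_r \<beta> \<psi> (P M) M (h M) (W M) j = cap (a * r M / (1 + a * (M - r M) + b * M + d))"
    if "1 \<le> M" for M
    using rate_eq[where \<beta>=\<beta> and j=j, OF model[rule_format, OF that] that pf pr \<beta> \<beta>_pos unit]
    unfolding a_def b_def d_def r_def k_def residual_fraction[where \<beta>=\<beta>, OF pr \<beta>] \<tau> sum_distrib_right .
  \<comment> \<open>The denominator of the claimed limit; \<open>a\<close> and \<open>b\<close>
    share the positive factor p_f p_r \<tau>, which cancels in a / b.\<close>
  define q where "q = (\<Sum>l\<in>UNIV - {j}. (\<beta> j l)\<^sup>2 / k l)"
  have a_eq: "a = p_f * p_r * \<tau> * ((\<beta> j j)\<^sup>2 / k j)"
    by (simp add: a_def power2_eq_square)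
  have b_eq: "b = p_f * p_r * \<tau> * q"
    unfolding b_def q_def sum_distrib_left by (intro sum.cong) (simp_all add: power2_eq_square)
  \<comment> \<open>All kappas are positive, so weighting the squares by their inverses does not
    change when the sum vanishes.\<close>
  have "q = 0 \<longleftrightarrow> (\<forall>l\<in>UNIV - {j}. (\<beta> j l)\<^sup>2 / k l = 0)"
    unfolding q_def using k[THEN less_imp_le] by (intro sum_nonneg_eq_0_iff) auto
  also have "\<dots> \<longleftrightarrow> (\<Sum>l\<in>UNIV - {j}. (\<beta> j l)\<^sup>2) = 0"
    using k[THEN less_imp_neq] by (subst sum_nonneg_eq_0_iff) auto
  finally have b0: "b = 0 \<longleftrightarrow> (\<Sum>l\<in>UNIV - {j}. (\<beta> j l)\<^sup>2) = 0"
    using pf pr \<tau>_pos by (simp add: b_eq)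
  have ab: "a / b = ((\<beta> j j)\<^sup>2 / k j) / q"
    using pf pr \<tau>_pos unfolding a_eq b_eq by (intro mult_divide_mult_cancel_left) auto
  have "(\<lambda>M. ereal (cap (a * r M / (1 + a * (M - r M) + b * M + d)))) \<longlonglongrightarrow> (if b = 0 then \<infinity> else ereal (cap (a / b)))"
    by (rule cap_ratio_limit[OF _ a b d]) (auto simp: r_def Gamma_ratio_square_asymp Gamma_ratio_bounds)
  \<comment> \<open>The model is assumed for M at least 1, so the sequences are compared only
    eventually.\<close>
  then have "(\<lambda>M. ereal (rate p_f p_r \<beta> \<psi> (P M) M (h M) (W M) j)) \<longlonglongrightarrow> (if b = 0 then \<infinity> else ereal (cap (a / b)))"
    by (rule Lim_transform_eventually) (rule eventually_mono[OF eventually_ge_at_top[of "1::nat"]], simp only: rate)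
  then show "(\<lambda>M. ereal (rate p_f p_r \<beta> \<psi> (P M) M (h M) (W M) j)) \<longlonglongrightarrow>
          (if (\<Sum>l\<in>UNIV - {j}. (\<beta> j l)\<^sup>2) = 0 then \<infinity>
           else ereal (cap (((\<beta> j j)\<^sup>2 / (1 + p_r * \<tau> * (\<Sum>i\<in>UNIV. \<beta> i j))) /
                  (\<Sum>l\<in>UNIV - {j}. (\<beta> j l)\<^sup>2 / (1 + p_r * \<tau> * (\<Sum>i\<in>UNIV. \<beta> i l))))))"
    unfolding b0 ab q_def k_def kappa_def .
qed

end
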